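(* Consider the multi-agent system and the predictor-like protocol described in the context, with $N\ge2$ agents, connected undirected graph $\mathcal{G}$, and scalar agents: $n=m=1$, $A=a\ge1$ and $B=b>0$ constants. Then the multi-agent system is mean-square consensusable under the predictor-like protocol if and only if $$\frac{\mu^2}{\mu^2+a^{2d}\sigma^2}\left[1-\frac{\big(\lambda_N(L_G)-\lambda_2(L_G)\big)^2}{\big(\lambda_2(L_G)+\lambda_N(L_G)\big)^2}\right]>1-\frac1{a^2}.$$
   Context: Graph: $\mathcal{G}$ is an undirected graph on vertices $\{1,\dots,N\}$ with symmetric weighted adjacency matrix $\mathcal{A}=[a_{ij}]$, $a_{ij}\ge 0$, and $a_{ij}>0$ iff $(i,j)$ is an edge. $N_i$ is the set of neighbours of $i$. The Laplacian is $L_G=\mathcal{D}-\mathcal{A}$ with $\mathcal{D}=\mathrm{diag}(d_1,\dots,d_N)$, $d_i=\sum_j a_{ij}$. Its eigenvalues are ordered $0=\lambda_1(L_G)\le\lambda_2(L_G)\le\cdots\le\lambda_N(L_G)$. System: for $i=1,\dots,N$ and $k\ge0$, $$x_i(k+1)=Ax_i(k)+\gamma(k)Bu_i(k-d),$$ with $x_i\in\mathbb{R}^n$, $u_i\in\mathbb{R}^m$, constant real $A,B$, integer delay $d\ge0$, and $\{\gamma(k)\}_{k\ge0}$ i.i.d. Bernoulli (the same process for all agents) with $P(\gamma(k)=0)=p$, $P(\gamma(k)=1)=1-p$, $p\in(0,1)$. The initial values $x_i(0),u_i(-1),\dots,u_i(-d)$ are given. Put $\mu=1-p$, $\sigma^2=p(1-p)$.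 Predictor-like protocol with gain $K\in\mathbb{R}^{m\times n}$: for $k\ge d$, $$\hat x_i(k|k-d)=A^dx_i(k-d)+\mu\sum_{j=1}^{d}A^{j-1}Bu_i(k-d-j),$$ $$u_i(k-d)=K\sum_{j\in N_i}a_{ij}\big[\hat x_j(k|k-d)-\hat x_i(k|k-d)\big].$$ Mean-square consensusable under the protocol: there exists a gain $K$ such that, for any finite initial values, the protocol yields $\lim_{k\to\infty}E\|x_j(k)-x_i(k)\|^2=0$ for all $i,j$. *)

theory Defs
  imports
    "HOL-Probability.Probability"
    "Jordan_Normal_Form.Char_Poly"
begin

(* The graph is given by its weighted adjacency matrix; vertices are 0, ..., N - 1 with
   N = dim_row Adj.  Self-loops are not excluded: they cancel both in the Laplacian and in
   the protocol. *)

definition weighted_graph :: "nat \<Rightarrow> real mat \<Rightarrow> bool" where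
  "weighted_graph N Adj \<longleftrightarrow>
     Adj \<in> carrier_mat N N \<and> transpose_mat Adj = Adj \<and>
     (\<forall>i<N. \<forall>j<N. 0 \<le> Adj $$ (i, j))"

definition edges :: "real mat \<Rightarrow> (nat \<times> nat) set" where
  "edges Adj = {(i, j). i < dim_row Adj \<and> j < dim_row Adj \<and> 0 < Adj $$ (i, j)}"

definition neighbours :: "real mat \<Rightarrow> nat \<Rightarrow> nat set" where
  "neighbours Adj i = {j. (i, j) \<in> edges Adj}"

definition connected_graph :: "real mat \<Rightarrow> bool" where
  "connected_graph Adj \<longleftrightarrow>
     (\<forall>i<dim_row Adj. \<forall>j<dim_row Adj. (i, j) \<in> (edges Adj)\<^sup>*)"

definition laplacian :: "real mat \<Rightarrow> real mat" where
  "laplacian Adj =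
     mat_diag (dim_row Adj) (\<lambda>i. \<Sum>j<dim_row Adj. Adj $$ (i, j)) - Adj"

(* The k-th smallest eigenvalue, counted with multiplicity, for 1 \<le> k \<le> N.  The Laplacian is
   real symmetric, so its characteristic polynomial has N real roots. *)
definition lap_eigenvalue :: "real mat \<Rightarrow> nat \<Rightarrow> real" where
  "lap_eigenvalue Adj k =
     sorted_list_of_multiset (proots (char_poly (laplacian Adj))) ! (k - 1)"

(* Signals along one sample path: x i k is x_i(k) for k \<ge> 0, and u i t is u_i(t) for integer
   t \<ge> -d.  The scalar g k is the realisation of gamma(k). *)

definition plant ::
  "nat \<Rightarrow> real \<Rightarrow> real \<Rightarrow> nat \<Rightarrow> (nat \<Rightarrow> real) \<Rightarrow>
   (nat \<Rightarrow> nat \<Rightarrow> real) \<Rightarrow> (nat \<Rightarrow> int \<Rightarrow> real) \<Rightarrow> bool" where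
  "plant N a b d g x u \<longleftrightarrow>
     (\<forall>i<N. \<forall>k. x i (k + 1) = a * x i k + g k * b * u i (int k - int d))"

(* predicted_state a b d \<mu> x u i k is the predictor of x_i(k) from time k - d (for k \<ge> d) *)
definition predicted_state ::
  "real \<Rightarrow> real \<Rightarrow> nat \<Rightarrow> real \<Rightarrow>
   (nat \<Rightarrow> nat \<Rightarrow> real) \<Rightarrow> (nat \<Rightarrow> int \<Rightarrow> real) \<Rightarrow> nat \<Rightarrow> nat \<Rightarrow> real" where
  "predicted_state a b d \<mu> x u i k =
     a ^ d * x i (k - d) +
     \<mu> * (\<Sum>j = 1..d. a ^ (j - 1) * b * u i (int k - int d - int j))"

definition predictor_protocol ::
  "real mat \<Rightarrow> real \<Rightarrow> real \<Rightarrow> nat \<Rightarrow> real \<Rightarrow> real \<Rightarrow>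
   (nat \<Rightarrow> nat \<Rightarrow> real) \<Rightarrow> (nat \<Rightarrow> int \<Rightarrow> real) \<Rightarrow> bool" where
  "predictor_protocol Adj a b d \<mu> K x u \<longleftrightarrow>
     (\<forall>i<dim_row Adj. \<forall>k\<ge>d.
        u i (int k - int d) =
          K * (\<Sum>j\<in>neighbours Adj i. Adj $$ (i, j) *
                 (predicted_state a b d \<mu> x u j k - predicted_state a b d \<mu> x u i k)))"

(* u0 i l is the initial input u_i(-l) *)
definition initial_values ::
  "nat \<Rightarrow> nat \<Rightarrow> (nat \<Rightarrow> real) \<Rightarrow> (nat \<Rightarrow> nat \<Rightarrow> real) \<Rightarrow>
   (nat \<Rightarrow> nat \<Rightarrow> real) \<Rightarrow> (nat \<Rightarrow> int \<Rightarrow> real) \<Rightarrow> bool" where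
  "initial_values N d x0 u0 x u \<longleftrightarrow>
     (\<forall>i<N. x i 0 = x0 i \<and> (\<forall>l\<in>{1..d}. u i (- int l) = u0 i l))"

definition closed_loop ::
  "real mat \<Rightarrow> real \<Rightarrow> real \<Rightarrow> nat \<Rightarrow> real \<Rightarrow> real \<Rightarrow> (nat \<Rightarrow> real) \<Rightarrow> (nat \<Rightarrow> nat \<Rightarrow> real) \<Rightarrow>
   (nat \<Rightarrow> real) \<Rightarrow> (nat \<Rightarrow> nat \<Rightarrow> real) \<Rightarrow> (nat \<Rightarrow> int \<Rightarrow> real) \<Rightarrow> bool" where
  "closed_loop Adj a b d \<mu> K x0 u0 g x u \<longleftrightarrow>
     initial_values (dim_row Adj) d x0 u0 x u \<and>
     plant (dim_row Adj) a b d g x u \<and>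
     predictor_protocol Adj a b d \<mu> K x u"

(* Processes x and u carry the sample point as last argument; the closed loop determines them
   (lemmas closed_loop_exists and closed_loop_unique). *)
definition mean_square_consensusable ::
  "'w measure \<Rightarrow> (nat \<Rightarrow> 'w \<Rightarrow> real) \<Rightarrow> real mat \<Rightarrow> real \<Rightarrow> real \<Rightarrow> nat \<Rightarrow> real \<Rightarrow> bool" where
  "mean_square_consensusable M \<gamma> Adj a b d \<mu> \<longleftrightarrow>
     (\<exists>K::real. \<forall>x0 u0. \<forall>x u.
        (\<forall>\<omega>\<in>space M. closed_loop Adj a b d \<mu> K x0 u0
           (\<lambda>k. \<gamma> k \<omega>) (\<lambda>i k. x i k \<omega>) (\<lambda>i t. u i t \<omega>)) \<longrightarrow>
        (\<forall>i<dim_row Adj. \<forall>j<dim_row Adj.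
           (\<lambda>k. \<integral>\<omega>. \<bar>x j k \<omega> - x i k \<omega>\<bar>\<^sup>2 \<partial>M) \<longlonglongrightarrow> 0))"

lemma closed_loop_unique:
  assumes "closed_loop Adj a b d \<mu> K x0 u0 g x u" "closed_loop Adj a b d \<mu> K x0 u0 g x' u'"
    and "i < dim_row Adj"
  shows "x i k = x' i k" and "t \<ge> - int d \<Longrightarrow> u i t = u' i t"
proof -
  define N where "N = dim_row Adj"
  have nb: "j < N" if "j \<in> neighbours Adj i" for i j
    using that by (auto simp: neighbours_def edges_def N_def)
  have all: "\<forall>i<N. x i k = x' i k \<and>
      (\<forall>t. - int d \<le> t \<and> t < int k \<longrightarrow> u i t = u' i t)" for k
  proof (induction k)
    case 0
    show ?case
    proof (intro allI impI conjI)
      fix i assume i: "i < N"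
      show "x i 0 = x' i 0"
        using assms i by (simp add: closed_loop_def initial_values_def N_def)
      fix t assume t: "- int d \<le> t \<and> t < int 0"
      then have "nat (- t) \<in> {1..d}" "t = - int (nat (- t))" by auto
      then show "u i t = u' i t"
        using assms(1,2) i unfolding closed_loop_def initial_values_def N_def by metis
    qed
  next
    case (Suc k)
    have pred: "predicted_state a b d \<mu> x u j (k + d) = predicted_state a b d \<mu> x' u' j (k + d)"
      if "j < N" for j
      using Suc that by (auto simp: predicted_state_def intro!: sum.cong)
    have uk: "u i (int k) = u' i (int k)" if "i < N" for i
    proof -
      have 1: "u i (int (k + d) - int d) = K * (\<Sum>j\<in>neighbours Adj i. Adj $$ (i, j) *
                 (predicted_state a b d \<mu> x u j (k + d) - predicted_state a b d \<mu> x u i (k + d)))"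
        using assms(1) that
        by (auto simp: closed_loop_def predictor_protocol_def N_def simp del: of_nat_add)
      have 2: "u' i (int (k + d) - int d) = K * (\<Sum>j\<in>neighbours Adj i. Adj $$ (i, j) *
                 (predicted_state a b d \<mu> x' u' j (k + d) - predicted_state a b d \<mu> x' u' i (k + d)))"
        using assms(2) that
        by (auto simp: closed_loop_def predictor_protocol_def N_def simp del: of_nat_add)
      have "u i (int (k + d) - int d) = u' i (int (k + d) - int d)"
        unfolding 1 2 using pred nb that by (auto intro!: sum.cong)
      then show ?thesis by simp
    qed
    have useq: "u i t = u' i t" if "i < N" "- int d \<le> t" "t < int (Suc k)" for i t
      using uk Suc that by (cases "t = int k") auto
    have xs: "x i (Suc k) = x' i (Suc k)" if "i < N" for i
    proof -
      have "u i (int k - int d) = u' i (int k - int d)"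
        using that by (intro useq) auto
      then show ?thesis
        using assms(1,2) Suc that by (simp add: closed_loop_def plant_def N_def)
    qed
    show ?case using useq xs by blast
  qed
  show "x i k = x' i k" using all assms(3) by (simp add: N_def)
  show "u i t = u' i t" if "t \<ge> - int d"
    using all[of "nat (t + 1)"] assms(3) that
    by (auto simp: N_def dest!: spec[of _ i] spec[of _ t])
qed

lemma closed_loop_exists: "\<exists>x u. closed_loop Adj a b d \<mu> K x0 u0 g x u"
proof -
  define N where "N = dim_row Adj"
  define inp where "inp k xc w = (\<lambda>i t. if t = int k then
      K * (\<Sum>j\<in>neighbours Adj i. Adj $$ (i, j) *
        ((a ^ d * xc j + \<mu> * (\<Sum>l = 1..d. a ^ (l - 1) * b * w j (int k - int l))) -
         (a ^ d * xc i + \<mu> * (\<Sum>l = 1..d. a ^ (l - 1) * b * w i (int k - int l)))))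
      else w i t)" for k :: nat and xc :: "nat \<Rightarrow> real" and w :: "nat \<Rightarrow> int \<Rightarrow> real"
  (* S k: the states at time k together with all inputs up to time k *)
  define S where "S = rec_nat (x0, inp 0 x0 (\<lambda>i t. u0 i (nat (- t))))
     (\<lambda>k (xc, w). let xn = (\<lambda>i. a * xc i + g k * b * w i (int k - int d))
                  in (xn, inp (Suc k) xn w))"
  define X where "X i k = fst (S k) i" for i k
  define W where "W k = snd (S k)" for k
  define U where "U i t = W (nat t) i t" for i t
  have S0: "fst (S 0) = x0" "W 0 = inp 0 x0 (\<lambda>i t. u0 i (nat (- t)))"
    by (simp_all add: S_def W_def)
  have X1: "X i (Suc k) = a * X i k + g k * b * W k i (int k - int d)" for i k
    by (simp add: X_def W_def S_def Let_def split: prod.splits)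
  have W1: "W (Suc k) = inp (Suc k) (\<lambda>i. X i (Suc k)) (W k)" for k
    by (simp add: X_def W_def S_def Let_def split: prod.splits)
  have step: "W (Suc k) i t = W k i t" if "t \<noteq> int (Suc k)" for k i t
    unfolding W1 using that by (simp add: inp_def)
  have stable: "W (n + k) i t = W n i t" if "t \<le> int n" for n k i t
    using that by (induction k) (auto simp: step)
  have WU: "W k i t = U i t" if "t \<le> int k" for k i t
    using stable[of t "nat t" "k - nat t" i] that unfolding U_def by simp
  have Uinp: "U i (int k) = K * (\<Sum>j\<in>neighbours Adj i. Adj $$ (i, j) *
        ((a ^ d * X j k + \<mu> * (\<Sum>l = 1..d. a ^ (l - 1) * b * U j (int k - int l))) -
         (a ^ d * X i k + \<mu> * (\<Sum>l = 1..d. a ^ (l - 1) * b * U i (int k - int l)))))" for i k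
  proof (cases k)
    case 0
    have neg: "U j (- int l) = u0 j l" if "l \<in> {1..d}" for j l
      using that by (simp add: U_def S0 inp_def)
    show ?thesis
      using 0 neg by (simp add: U_def S0 inp_def X_def cong: sum.cong_simp)
  next
    case (Suc m)
    have prev: "W m j (int (Suc m) - int l) = U j (int (Suc m) - int l)" if "l \<in> {1..d}" for j l
      using that by (intro WU) auto
    have "U i (int k) = inp (Suc m) (\<lambda>i. X i (Suc m)) (W m) i (int (Suc m))"
      unfolding Suc U_def W1[symmetric] nat_int ..
    also have "\<dots> = K * (\<Sum>j\<in>neighbours Adj i. Adj $$ (i, j) *
        ((a ^ d * X j k + \<mu> * (\<Sum>l = 1..d. a ^ (l - 1) * b * U j (int k - int l))) -
         (a ^ d * X i k + \<mu> * (\<Sum>l = 1..d. a ^ (l - 1) * b * U i (int k - int l)))))"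
      using prev Suc unfolding inp_def by (simp del: of_nat_Suc cong: sum.cong_simp)
    finally show ?thesis .
  qed
  have "initial_values N d x0 u0 X U"
    by (auto simp: initial_values_def X_def S0 U_def inp_def)
  moreover have "plant N a b d g X U"
    by (auto simp: plant_def X1 WU)
  moreover have "predictor_protocol Adj a b d \<mu> K X U"
    unfolding predictor_protocol_def predicted_state_def
  proof (intro allI impI)
    fix i k assume "i < dim_row Adj" "d \<le> k"
    then have k: "int k - int d = int (k - d)" by simp
    show "U i (int k - int d) = K * (\<Sum>j\<in>neighbours Adj i. Adj $$ (i, j) *
        ((a ^ d * X j (k - d) + \<mu> * (\<Sum>j' = 1..d. a ^ (j' - 1) * b * U j (int k - int d - int j'))) -
         (a ^ d * X i (k - d) + \<mu> * (\<Sum>j = 1..d. a ^ (j - 1) * b * U i (int k - int d - int j)))))"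
      unfolding k by (rule Uinp)
  qed
  ultimately show ?thesis
    by (auto simp: closed_loop_def N_def)
qed

end

theory Submission
  imports Defs "Jordan_Normal_Form.Schur_Decomposition"
begin

text \<open>
  Projecting onto an orthonormal eigenbasis of the Laplacian decouples the closed loop into scalar
  modes \<open>z\<close> with input \<open>w\<close>, one for each eigenvalue \<open>\<lambda>\<close>; consensus means that the modes orthogonal
  to the constants vanish in mean square. The predictor \<open>Y(m)\<close> of a mode depends only on
  \<open>\<gamma>(0), \<dots>, \<gamma>(m - 1)\<close> and satisfies, with \<open>\<kappa> = K \<lambda>\<close> and \<open>w(m) = - \<kappa> Y(m)\<close>,
  \<open>Y(m + 1) = (a - \<mu> b \<kappa>) Y(m) + (\<gamma>(m) - \<mu>) a\<^sup>d b w(m - d)\<close>.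
  The noise \<open>\<gamma>(m) - \<mu>\<close> is centred and independent of the rest, so
  \<open>V(m) = E Y(m)\<^sup>2 + c \<Sum>\<^sub>j E w(m - j)\<^sup>2\<close> (sum over \<open>1 \<le> j \<le> d\<close>, \<open>c = a\<^bsup>2d\<^esup> \<sigma>\<^sup>2 b\<^sup>2\<close>) changes by
  exactly \<open>- \<delta> E Y(m)\<^sup>2\<close> with \<open>\<delta> = 1 - (a - \<mu> b \<kappa>)\<^sup>2 - c \<kappa>\<^sup>2\<close>. Hence a mode is stable iff \<open>\<delta> > 0\<close>.
  A single gain \<open>K\<close> achieves this for all \<open>\<lambda>\<close> between \<open>\<lambda>\<^sub>2\<close> and \<open>\<lambda>\<^sub>N\<close> iff the stated inequality
  holds, the best choice being \<open>b K = 2 a \<mu> / ((\<mu>\<^sup>2 + a\<^bsup>2d\<^esup> \<sigma>\<^sup>2) (\<lambda>\<^sub>2 + \<lambda>\<^sub>N))\<close>.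
\<close>

subsection \<open>Symmetric matrices and the Laplacian\<close>

text \<open>Gram-Schmidt keeps the head of its input, so a basis completion of \<open>v\<close>
  becomes an orthogonal basis that still starts with \<open>v\<close>. Normalising it gives the
  columns of \<open>W\<close>; the witness for \<open>c\<close> is the norm of
  \<open>v\<close>.\<close>

lemma orthonormal_completion:
  fixes v :: "real vec"
  assumes v: "v \<in> carrier_vec n" "v \<noteq> 0\<^sub>v n"
  obtains W c where "W \<in> carrier_mat n n" "transpose_mat W * W = 1\<^sub>m n"
    "v = c \<cdot>\<^sub>v col W 0"
proof -
  interpret cof_vec_space n "TYPE(real)" .
  define bs where "bs = basis_completion v"
  define ws where "ws = gram_schmidt n bs"
  from basis_completion[OF v, folded bs_def]
  have bs: "distinct bs" "\<not> lin_dep (set bs)" "set bs \<subseteq> carrier_vec n" "hd bs = v" "length bs = n"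
    by auto
  have n: "n > 0"
  proof (rule ccontr)
    assume "\<not> n > 0"
    with v(1) have "v = 0\<^sub>v n" by (intro eq_vecI) auto
    with v(2) show False ..
  qed
  with bs(4,5) obtain vs where bv: "bs = v # vs" by (cases bs) auto
  from gram_schmidt_result[OF bs(3) bs(1) bs(2) refl, folded ws_def]
  have ws: "set ws \<subseteq> carrier_vec n" "corthogonal ws" "length ws = n"
    by (auto simp: bs(5))
  have hdws: "hd ws = v" using gram_schmidt_hd[OF v(1), of vs, folded bv] by (simp add: ws_def)
  have wsc: "ws ! i \<in> carrier_vec n" if "i < n" for i using ws that by auto
  have orth: "ws ! i \<bullet> ws ! j = 0 \<longleftrightarrow> i \<noteq> j" if "i < n" "j < n" for i j
  proof -
    have "conjugate (ws ! j) = ws ! j" by (rule eq_vecI) simp_all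
    moreover have "ws ! i \<bullet>c ws ! j = 0 \<longleftrightarrow> i \<noteq> j"
      using ws(2,3) that unfolding corthogonal_def by simp
    ultimately show ?thesis by simp
  qed
  define r where "r i = sqrt (ws ! i \<bullet> ws ! i)" for i
  have nn: "ws ! i \<bullet> ws ! i \<ge> 0" for i
    by (auto simp: scalar_prod_def intro!: sum_nonneg)
  have r: "r i \<noteq> 0" "r i * r i = ws ! i \<bullet> ws ! i" if "i < n" for i
    using orth[OF that that] nn[of i] by (auto simp: r_def)
  define W where "W = mat n n (\<lambda>(i, j). ws ! j $ i / r j)"
  have W: "W \<in> carrier_mat n n" by (simp add: W_def)
  have "transpose_mat W * W = 1\<^sub>m n"
  proof (rule eq_matI)
    fix i j assume "i < dim_row (1\<^sub>m n)" "j < dim_col (1\<^sub>m n)"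
    then have ij: "i < n" "j < n" by auto
    have "(transpose_mat W * W) $$ (i, j) = (\<Sum>k = 0..<n. ws ! i $ k / r i * (ws ! j $ k / r j))"
      using ij by (simp add: W_def scalar_prod_def)
    also have "\<dots> = (\<Sum>k = 0..<n. ws ! i $ k * ws ! j $ k) / (r i * r j)"
      by (simp add: sum_divide_distrib)
    also have "(\<Sum>k = 0..<n. ws ! i $ k * ws ! j $ k) = ws ! i \<bullet> ws ! j"
      using wsc[OF ij(2)] by (simp add: scalar_prod_def)
    finally show "(transpose_mat W * W) $$ (i, j) = 1\<^sub>m n $$ (i, j)"
      using orth[OF ij] r[OF ij(1)] ij by (cases "i = j") auto
  qed (simp_all add: W_def)
  moreover have "v = r 0 \<cdot>\<^sub>v col W 0"
  proof (rule eq_vecI)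
    have "ws ! 0 = v" using hdws ws(3) n by (cases ws) auto
    then show "v $ i = (r 0 \<cdot>\<^sub>v col W 0) $ i" if "i < dim_vec (r 0 \<cdot>\<^sub>v col W 0)" for i
      using that n r[OF n] by (simp add: W_def)
  qed (use v(1) W in simp)
  ultimately show ?thesis by (rule that[OF W])
qed

lemma symmetric_sandwich:
  fixes A W :: "'a :: comm_ring_1 mat"
  assumes "A \<in> carrier_mat n n" "transpose_mat A = A" "W \<in> carrier_mat n n"
  shows "transpose_mat (transpose_mat W * A * W) = transpose_mat W * A * W"
proof -
  have "transpose_mat (transpose_mat W * A * W) = transpose_mat W * transpose_mat (transpose_mat W * A)"
    using assms by (subst transpose_mult) auto
  also have "transpose_mat (transpose_mat W * A) = A * W"
    using assms by (subst transpose_mult) auto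
  finally show ?thesis using assms by (simp add: assoc_mult_mat[of _ n n _ n _ n])
qed

text \<open>Deflation, by induction on the list of roots: an orthogonal change of basis starting
  with a unit eigenvector for \<open>e\<close> splits off a 1 by 1 block, and the symmetric
  remainder has the other roots. The diagonal follows the order of \<open>es\<close>, so the order
  of the eigenvalues can be prescribed.\<close>

lemma symmetric_diagonalization:
  fixes A :: "real mat"
  assumes "A \<in> carrier_mat n n" "transpose_mat A = A"
    "char_poly A = (\<Prod>e\<leftarrow>es. [:- e, 1:])"
  shows "\<exists>P \<in> carrier_mat n n. transpose_mat P * P = 1\<^sub>m n \<and>
     transpose_mat P * A * P = mat n n (\<lambda>(i, j). if i = j then es ! i else 0)"
  using assms
proof (induction es arbitrary: n A)
  case Nil
  with degree_monic_char_poly[of A n] have n: "n = 0" by auto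
  show ?case unfolding n by (intro bexI[of _ "1\<^sub>m 0"] conjI eq_matI) simp_all
next
  case (Cons e es n A)
  note A = Cons.prems(1)
  from Cons.prems(3) have cp: "char_poly A = [: -e, 1 :] * (\<Prod>e \<leftarrow> es. [:- e, 1:])" by simp
  have mon: "monic (\<Prod>e\<leftarrow> es. [:- e, 1:])" by (rule monic_prod_list) auto
  have "degree (char_poly A) = Suc (degree (\<Prod>e\<leftarrow> es. [:- e, 1:]))"
    unfolding cp using mon by (subst degree_mult_eq) auto
  with degree_monic_char_poly[OF A] obtain m where n: "n = Suc m" by (cases n) auto
  have "eigenvalue A e" unfolding eigenvalue_root_char_poly[OF A] cp by simp
  then obtain v where v: "v \<in> carrier_vec n" "v \<noteq> 0\<^sub>v n" "A *\<^sub>v v = e \<cdot>\<^sub>v v"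
    using A by (auto simp: eigenvalue_def eigenvector_def)
  obtain W c where W: "W \<in> carrier_mat n n" "transpose_mat W * W = 1\<^sub>m n" "v = c \<cdot>\<^sub>v col W 0"
    by (rule orthonormal_completion[OF v(1,2)])
  have c: "c \<noteq> 0" using v(2) W by auto
  have colW: "A *\<^sub>v col W 0 = e \<cdot>\<^sub>v col W 0"
  proof -
    have cw: "col W 0 \<in> carrier_vec n" by (rule carrier_vecI) (use W(1) in simp)
    have "col W 0 = inverse c \<cdot>\<^sub>v v" using c unfolding W(3) by (simp add: smult_smult_assoc)
    then have "A *\<^sub>v col W 0 = inverse c \<cdot>\<^sub>v (A *\<^sub>v v)" using A v by (simp add: mult_mat_vec)
    also have "\<dots> = e \<cdot>\<^sub>v (inverse c \<cdot>\<^sub>v v)" by (simp add: v(3) smult_smult_assoc mult.commute)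
    also have "inverse c \<cdot>\<^sub>v v = col W 0" using c unfolding W(3) by (simp add: smult_smult_assoc)
    finally show ?thesis .
  qed
  define T where "T = transpose_mat W"
  have T: "T \<in> carrier_mat n n" using W by (simp add: T_def)
  have TW: "T * W = 1\<^sub>m n" using W by (simp add: T_def)
  have WT: "W * T = 1\<^sub>m n" using mat_mult_left_right_inverse[OF T W(1) TW] .
  define A' where "A' = T * A * W"
  have A': "A' \<in> carrier_mat n n" using A T W by (simp add: A'_def)
  have symA': "transpose_mat A' = A'"
    unfolding A'_def T_def using symmetric_sandwich[OF A Cons.prems(2) W(1)] .
  have sim: "similar_mat A' A"
    unfolding similar_mat_def
    by (intro exI[of _ T] exI[of _ W] similar_mat_witI[of _ _ n]) (use TW WT A A' T W in \<open>auto simp: A'_def\<close>)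
  have col0: "A' $$ (i, 0) = (if i = 0 then e else 0)" if i: "i < n" for i
  proof -
    have "A' $$ (i, 0) = (T * (A * W)) $$ (i, 0)" using A T W by (simp add: A'_def)
    also have "\<dots> = row T i \<bullet> col (A * W) 0" using i n A T W by simp
    also have "col (A * W) 0 = e \<cdot>\<^sub>v col W 0" using col_mult2[OF A W(1), of 0] n colW by simp
    also have "row T i \<bullet> (e \<cdot>\<^sub>v col W 0) = e * (row T i \<bullet> col W 0)"
      by (intro scalar_prod_smult_distrib[of _ n] carrier_vecI) (use T W(1) in simp_all)
    also have "row T i \<bullet> col W 0 = (T * W) $$ (i, 0)" using i n T W by simp
    finally show ?thesis using i n by (simp add: TW)
  qed
  \<comment> \<open>The eigenvector only clears the first column; symmetry clears the first row as
    well and makes the matrix block diagonal.\<close>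
  have row0: "A' $$ (0, i) = (if i = 0 then e else 0)" if i: "i < n" for i
    using col0[OF i] arg_cong[OF symA', of "\<lambda>B. B $$ (i, 0)"] i n A' by simp
  define A3 where "A3 = mat m m (\<lambda>(i, j). A' $$ (Suc i, Suc j))"
  have A3: "A3 \<in> carrier_mat m m" by (simp add: A3_def)
  have blk: "A' = four_block_mat (mat 1 1 (\<lambda>_. e)) (0\<^sub>m 1 m) (0\<^sub>m m 1) A3"
    by (rule eq_matI) (use A' n col0 row0 in \<open>auto simp: A3_def\<close>)
  have symA3: "transpose_mat A3 = A3"
  proof (rule eq_matI)
    fix i j assume "i < dim_row A3" "j < dim_col A3"
    then show "transpose_mat A3 $$ (i, j) = A3 $$ (i, j)"
      using arg_cong[OF symA', of "\<lambda>B. B $$ (Suc i, Suc j)"] A' n by (simp add: A3_def)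
  qed (simp_all add: A3_def)
  have "char_poly A' = char_poly (mat 1 1 (\<lambda>_. e)) * char_poly A3"
    unfolding blk by (rule char_poly_four_block_zeros_col) (use A3 in auto)
  also have "char_poly (mat 1 1 (\<lambda>_. e)) = [: -e,1 :]"
    by (simp add: char_poly_defs det_def sign_def)
  finally have "[: -e, 1 :] * char_poly A3 = [: -e, 1 :] * (\<Prod>e \<leftarrow> es. [:- e, 1:])"
    using char_poly_similar[OF sim] cp by simp
  then have "char_poly A3 = (\<Prod> e \<leftarrow> es. [:- e, 1:])"
    by (metis mult_cancel_left pCons_eq_0_iff zero_neq_one)
  from Cons.IH[OF A3 symA3 this] obtain Q where Q: "Q \<in> carrier_mat m m"
    "transpose_mat Q * Q = 1\<^sub>m m"
    "transpose_mat Q * A3 * Q = mat m m (\<lambda>(i, j). if i = j then es ! i else 0)" by blast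
  define R where "R = four_block_mat (1\<^sub>m 1) (0\<^sub>m 1 m) (0\<^sub>m m 1) Q"
  have R: "R \<in> carrier_mat n n" using Q n by (auto simp: R_def)
  have RT: "transpose_mat R = four_block_mat (1\<^sub>m 1) (0\<^sub>m 1 m) (0\<^sub>m m 1) (transpose_mat Q)"
    unfolding R_def using Q(1) by (subst transpose_four_block_mat[of _ 1 1 _ m _ m]) auto
  have RTc: "transpose_mat R \<in> carrier_mat n n" using R by simp
  have RR: "transpose_mat R * R = 1\<^sub>m n"
    unfolding RT unfolding R_def using Q
    by (subst mult_four_block_mat[of _ 1 1 _ m _ m _ _ 1 _ m]) (auto simp: n)
  have RAR: "transpose_mat R * A' * R = mat n n (\<lambda>(i, j). if i = j then (e # es) ! i else 0)"
  proof -
    have "transpose_mat R * A' = four_block_mat (mat 1 1 (\<lambda>_. e)) (0\<^sub>m 1 m) (0\<^sub>m m 1) (transpose_mat Q * A3)"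
      unfolding RT blk using Q A3
      by (subst mult_four_block_mat[of _ 1 1 _ m _ m _ _ 1 _ m]) auto
    also have "\<dots> * R = four_block_mat (mat 1 1 (\<lambda>_. e)) (0\<^sub>m 1 m) (0\<^sub>m m 1) (transpose_mat Q * A3 * Q)"
      unfolding R_def using Q A3
      by (subst mult_four_block_mat[of _ 1 1 _ m _ m _ _ 1 _ m]) auto
    also have "\<dots> = mat n n (\<lambda>(i, j). if i = j then (e # es) ! i else 0)"
      unfolding Q(3) by (rule eq_matI) (auto simp: n nth_Cons')
    finally show ?thesis .
  qed
  have P: "W * R \<in> carrier_mat n n" using W R by simp
  have PT: "transpose_mat (W * R) = transpose_mat R * T"
    unfolding T_def using W R by (subst transpose_mult) auto
  have "transpose_mat (W * R) * (W * R) = transpose_mat R * (T * W) * R"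
    unfolding PT using W R T RTc by (simp add: assoc_mult_mat[of _ n n _ n _ n])
  then have 1: "transpose_mat (W * R) * (W * R) = 1\<^sub>m n" using TW RR RTc by simp
  have "transpose_mat (W * R) * A * (W * R) = transpose_mat R * A' * R"
    unfolding PT A'_def using W R T A RTc by (simp add: assoc_mult_mat[of _ n n _ n _ n])
  with RAR 1 P show ?case by auto
qed

text \<open>Over the complex numbers the polynomial splits. For a root c with eigenvector v, the
  Hermitian form of v is real by symmetry and equals c times the squared norm of v, so c is real.
  Injectivity of the coefficient embedding returns the factorisation to the reals.\<close>

lemma symmetric_char_poly_splits:
  fixes A :: "real mat"
  assumes A: "A \<in> carrier_mat n n" and sym: "transpose_mat A = A"
  obtains as where "char_poly A = (\<Prod>a\<leftarrow>as. [:- a, 1:])" "length as = n"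
proof -
  let ?C = "map_mat complex_of_real A"
  have C: "?C \<in> carrier_mat n n" using A by simp
  have Asym: "A $$ (i, j) = A $$ (j, i)" if "i < n" "j < n" for i j
    using arg_cong[OF sym, of "\<lambda>B. B $$ (i, j)"] that A by simp
  from char_poly_factorized[OF C] obtain cs where cs:
    "char_poly ?C = (\<Prod>c\<leftarrow>cs. [:- c, 1:])" "length cs = n" by blast
  have real: "c \<in> \<real>" if c: "c \<in> set cs" for c
  proof -
    have "eigenvalue ?C c"
      unfolding eigenvalue_root_char_poly[OF C] cs using c by (simp add: poly_prod_list o_def prod_list_zero_iff)
    then obtain v where v: "v \<in> carrier_vec n" "v \<noteq> 0\<^sub>v n" "?C *\<^sub>v v = c \<cdot>\<^sub>v v"
      using C by (auto simp: eigenvalue_def eigenvector_def)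
    have Cv: "(\<Sum>j<n. A $$ (i, j) * v $ j) = c * v $ i" if "i < n" for i
      using arg_cong[OF v(3), of "\<lambda>w. w $ i"] that A v(1)
      by (simp add: scalar_prod_def atLeast0LessThan)
    define q where "q = (\<Sum>i<n. cnj (v $ i) * (\<Sum>j<n. A $$ (i, j) * v $ j))"
    have "cnj q = (\<Sum>i<n. \<Sum>j<n. v $ i * (A $$ (i, j) * cnj (v $ j)))"
      by (simp add: q_def sum_distrib_left)
    also have "\<dots> = (\<Sum>j<n. \<Sum>i<n. v $ i * (A $$ (i, j) * cnj (v $ j)))"
      by (rule sum.swap)
    also have "\<dots> = q"
      unfolding q_def sum_distrib_left by (intro sum.cong refl) (simp add: Asym mult_ac)
    finally have "q \<in> \<real>" by (simp add: Reals_cnj_iff)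
    have q: "q = c * of_real (\<Sum>i<n. (cmod (v $ i))\<^sup>2)"
    proof -
      have "q = (\<Sum>i<n. c * (v $ i * cnj (v $ i)))"
        unfolding q_def by (intro sum.cong refl) (subst Cv, auto simp: mult_ac)
      then show ?thesis
        by (simp add: sum_distrib_left complex_norm_square[symmetric] flip: of_real_power)
    qed
    have "(\<Sum>i<n. (cmod (v $ i))\<^sup>2) \<noteq> 0"
    proof
      assume "(\<Sum>i<n. (cmod (v $ i))\<^sup>2) = 0"
      then have "\<forall>i<n. v $ i = 0" by (subst (asm) sum_nonneg_eq_0_iff) auto
      then have "v = 0\<^sub>v n" using v by (intro eq_vecI) auto
      with v show False by simp
    qed
    then have "c = q / of_real (\<Sum>i<n. (cmod (v $ i))\<^sup>2)"
      unfolding q by (simp del: of_real_sum of_real_power)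
    with \<open>q \<in> \<real>\<close> show ?thesis by (metis Reals_divide Reals_of_real)
  qed
  interpret hp: map_poly_inj_comm_ring_hom complex_of_real ..
  have "map_poly complex_of_real (char_poly A) = char_poly ?C"
    by (simp add: of_real_hom.char_poly_hom[OF A])
  also have "\<dots> = map_poly complex_of_real (\<Prod>a\<leftarrow>map Re cs. [:- a, 1:])"
    unfolding cs using real
  proof (induction cs)
    case (Cons c cs)
    have "[:- c, 1:] = map_poly complex_of_real [:- Re c, 1:]"
      using Cons.prems by (simp add: complex_is_Real_iff complex_eq_iff)
    moreover have "(\<Prod>c\<leftarrow>cs. [:- c, 1:]) = map_poly complex_of_real (\<Prod>a\<leftarrow>map Re cs. [:- a, 1:])"
      using Cons by simp
    ultimately show ?case
      unfolding list.map prod_list.Cons by (simp only: hp.hom_mult)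
  qed simp
  finally have "char_poly A = (\<Prod>a\<leftarrow>map Re cs. [:- a, 1:])" by simp
  with cs that show ?thesis by (metis length_map)
qed

lemma proots_prod_list_linear:
  "proots (\<Prod>a\<leftarrow>as. [:- a, 1:]) = mset (as :: real list)"
proof (induction as)
  case (Cons a as)
  have "(\<Prod>a\<leftarrow>as. [:- a, 1:]) \<noteq> 0" by (auto simp: prod_list_zero_iff)
  then show ?case using Cons by (simp add: proots_mult del: mult_pCons_left)
qed simp

section \<open>Spectrum of the Laplacian of a connected weighted graph\<close>

text \<open>The degree of \<open>i\<close> multiplies \<open>v i\<close>, so every weight meets a
  difference. The weight of a self-loop cancels on the left and meets a zero difference on the
  right.\<close>

lemma laplacian_apply:
  assumes "Adj \<in> carrier_mat N N" "i < N"
  shows "(\<Sum>j<N. laplacian Adj $$ (i, j) * v j) = (\<Sum>j<N. Adj $$ (i, j) * (v i - v j))"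
proof -
  have "(\<Sum>j<N. laplacian Adj $$ (i, j) * v j) =
      (\<Sum>j<N. (if i = j then (\<Sum>k<N. Adj $$ (i, k)) * v j else 0) - Adj $$ (i, j) * v j)"
    using assms by (intro sum.cong refl) (auto simp: laplacian_def mat_diag_def left_diff_distrib)
  also have "\<dots> = (\<Sum>k<N. Adj $$ (i, k)) * v i - (\<Sum>j<N. Adj $$ (i, j) * v j)"
    using assms(2) by (simp add: sum_subtractf)
  finally show ?thesis by (simp add: right_diff_distrib sum_subtractf sum_distrib_right)
qed

lemma laplacian_symmetric:
  assumes "weighted_graph N Adj"
  shows "laplacian Adj \<in> carrier_mat N N" "transpose_mat (laplacian Adj) = laplacian Adj"
proof -
  have A: "Adj \<in> carrier_mat N N" "transpose_mat Adj = Adj"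
    using assms by (auto simp: weighted_graph_def)
  have sym: "Adj $$ (i, j) = Adj $$ (j, i)" if "i < N" "j < N" for i j
    using arg_cong[OF A(2), of "\<lambda>B. B $$ (i, j)"] that A(1) by simp
  show "laplacian Adj \<in> carrier_mat N N" using A(1) by (auto simp: laplacian_def mat_diag_def)
  show "transpose_mat (laplacian Adj) = laplacian Adj"
    by (rule eq_matI) (use A(1) sym in \<open>auto simp: laplacian_def mat_diag_def\<close>)
qed

text \<open>Adding the sum to its copy with \<open>i\<close> and \<open>j\<close> exchanged produces
  squares; this is where the factor 2 comes from.\<close>

lemma laplacian_quadratic_form:
  assumes "weighted_graph N Adj"
  shows "2 * (\<Sum>i<N. v i * (\<Sum>j<N. laplacian Adj $$ (i, j) * v j)) =
    (\<Sum>i<N. \<Sum>j<N. Adj $$ (i, j) * (v i - v j)\<^sup>2)"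
proof -
  have A: "Adj \<in> carrier_mat N N" "transpose_mat Adj = Adj"
    using assms by (auto simp: weighted_graph_def)
  have sym: "Adj $$ (i, j) = Adj $$ (j, i)" if "i < N" "j < N" for i j
    using arg_cong[OF A(2), of "\<lambda>B. B $$ (i, j)"] that A(1) by simp
  define q where "q = (\<Sum>i<N. \<Sum>j<N. v i * (Adj $$ (i, j) * (v i - v j)))"
  have "q = (\<Sum>j<N. \<Sum>i<N. v i * (Adj $$ (i, j) * (v i - v j)))"
    unfolding q_def by (rule sum.swap)
  also have "\<dots> = (\<Sum>i<N. \<Sum>j<N. v j * (Adj $$ (i, j) * (v j - v i)))"
    by (intro sum.cong refl) (simp add: sym)
  finally have "2 * q = (\<Sum>i<N. \<Sum>j<N. v i * (Adj $$ (i, j) * (v i - v j)) + v j * (Adj $$ (i, j) * (v j - v i)))"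
    by (simp add: q_def sum.distrib)
  also have "\<dots> = (\<Sum>i<N. \<Sum>j<N. Adj $$ (i, j) * (v i - v j)\<^sup>2)"
    by (intro sum.cong refl) (simp add: power2_eq_square algebra_simps)
  finally show ?thesis using A(1) by (simp add: laplacian_apply q_def sum_distrib_left)
qed

text \<open>The quadratic form vanishes on the kernel and, the weights being nonnegative, so does
  each of its summands. Values thus agree across every edge, and connectedness carries this along
  paths.\<close>

lemma laplacian_kernel_constant:
  assumes wg: "weighted_graph N Adj" and conn: "connected_graph Adj"
    and ker: "\<And>i. i < N \<Longrightarrow> (\<Sum>j<N. laplacian Adj $$ (i, j) * v j) = 0"
    and ij: "i < N" "j < N"
  shows "v i = (v j :: real)"
proof -
  have A: "dim_row Adj = N" "\<And>i j. i < N \<Longrightarrow> j < N \<Longrightarrow> 0 \<le> Adj $$ (i, j)"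
    using wg by (auto simp: weighted_graph_def)
  have "(\<Sum>i<N. \<Sum>j<N. Adj $$ (i, j) * (v i - v j)\<^sup>2) = 0"
    using laplacian_quadratic_form[OF wg, of v] ker by simp
  moreover have nn: "0 \<le> (\<Sum>j<N. Adj $$ (i, j) * (v i - v j)\<^sup>2)" if "i < N" for i
    using A(2) that by (intro sum_nonneg) auto
  ultimately have "(\<Sum>j<N. Adj $$ (i, j) * (v i - v j)\<^sup>2) = 0" if "i < N" for i
    using sum_nonneg_eq_0_iff[of "{..<N}" "\<lambda>i. \<Sum>j<N. Adj $$ (i, j) * (v i - v j)\<^sup>2"] that
    by auto
  then have z: "Adj $$ (i, j) * (v i - v j)\<^sup>2 = 0" if "i < N" "j < N" for i j
    using sum_nonneg_eq_0_iff[of "{..<N}" "\<lambda>j. Adj $$ (i, j) * (v i - v j)\<^sup>2"] A(2) that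
    by auto
  have "(i, j) \<in> (edges Adj)\<^sup>*" using conn ij A(1) by (auto simp: connected_graph_def)
  then show ?thesis
  proof (induction rule: rtrancl_induct)
    case (step k l)
    then have "k < N" "l < N" "Adj $$ (k, l) > 0" using A(1) by (auto simp: edges_def)
    with z[of k l] have "v k = v l" by fastforce
    with step.IH show ?case by simp
  qed simp
qed

text \<open>The modes are the columns of the diagonalising orthogonal matrix. Orthogonality of its
  columns makes the modes orthonormal, that of its rows allows states to be expanded in them. Modes
  count from 0 and eigenvalues from 1, hence \<open>Suc l\<close>.\<close>

lemma laplacian_modes:
  assumes N: "N \<ge> 2" and wg: "weighted_graph N Adj" and conn: "connected_graph Adj"
  obtains e :: "nat \<Rightarrow> nat \<Rightarrow> real" where
    "\<And>l i. l < N \<Longrightarrow> i < N \<Longrightarrow>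
       (\<Sum>j<N. laplacian Adj $$ (i, j) * e l j) = lap_eigenvalue Adj (Suc l) * e l i"
    "\<And>l m. l < N \<Longrightarrow> m < N \<Longrightarrow> (\<Sum>i<N. e l i * e m i) = (if l = m then 1 else 0)"
    "\<And>i j. i < N \<Longrightarrow> j < N \<Longrightarrow> (\<Sum>l<N. e l i * e l j) = (if i = j then 1 else 0)"
    "\<And>i j. i < N \<Longrightarrow> j < N \<Longrightarrow> e 0 i = e 0 j"
    "\<And>l. 1 \<le> l \<Longrightarrow> l < N \<Longrightarrow> 0 < lap_eigenvalue Adj (Suc l)"
    "\<And>l m. l \<le> m \<Longrightarrow> m < N \<Longrightarrow> lap_eigenvalue Adj (Suc l) \<le> lap_eigenvalue Adj (Suc m)"
proof -
  let ?L = "laplacian Adj"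
  note L = laplacian_symmetric[OF wg]
  obtain as where as: "char_poly ?L = (\<Prod>a\<leftarrow>as. [:- a, 1:])" "length as = N"
    using symmetric_char_poly_splits[OF L] .
  \<comment> \<open>Sorting before diagonalising ties column \<open>l\<close> to the eigenvalue with
    number \<open>Suc l\<close>.\<close>
  define es where "es = sorted_list_of_multiset (mset as)"
  have es: "mset es = mset as" "length es = N" "sorted es"
    using as(2) by (auto simp: es_def)
  have "char_poly ?L = (\<Prod>a\<leftarrow>es. [:- a, 1:])"
    unfolding as(1) using es(1) by (metis mset_map prod_mset_prod_list)
  from symmetric_diagonalization[OF L this] obtain P where P: "P \<in> carrier_mat N N"
    "transpose_mat P * P = 1\<^sub>m N"
    "transpose_mat P * ?L * P = mat N N (\<lambda>(i, j). if i = j then es ! i else 0)" by blast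
  have PT: "transpose_mat P \<in> carrier_mat N N" using P(1) by simp
  have PPT: "P * transpose_mat P = 1\<^sub>m N" using mat_mult_left_right_inverse[OF PT P(1,2)] .
  have ev: "lap_eigenvalue Adj (Suc l) = es ! l" for l
    by (simp add: lap_eigenvalue_def as(1) proots_prod_list_linear es_def)
  define e where "e l i = P $$ (i, l)" for l i
  \<comment> \<open>Read column by column, this turns the diagonal form into the eigenvector
    equations.\<close>
  have "?L * P = P * (transpose_mat P * ?L * P)"
  proof -
    have "P * (transpose_mat P * ?L * P) = (P * transpose_mat P) * (?L * P)"
      using P(1) PT L(1) by (simp add: assoc_mult_mat[of _ N N _ N _ N])
    also have "\<dots> = ?L * P" using L(1) P(1) by (simp add: PPT)
    finally show ?thesis ..
  qed
  then have LP: "?L * P = P * mat N N (\<lambda>(i, j). if i = j then es ! i else 0)" using P(3) by simp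
  have 1: "(\<Sum>j<N. ?L $$ (i, j) * e l j) = es ! l * e l i" if "l < N" "i < N" for l i
  proof -
    have "(\<Sum>j<N. ?L $$ (i, j) * e l j) = (?L * P) $$ (i, l)"
      using that P(1) L(1) by (simp add: e_def scalar_prod_def atLeast0LessThan)
    also have "\<dots> = (\<Sum>j<N. P $$ (i, j) * (if j = l then es ! j else 0))"
      unfolding LP using that P(1) by (simp add: scalar_prod_def atLeast0LessThan)
    also have "\<dots> = (\<Sum>j<N. if j = l then P $$ (i, j) * es ! j else 0)"
      by (intro sum.cong) auto
    finally show ?thesis using that by (simp add: e_def mult.commute)
  qed
  have 2: "(\<Sum>i<N. e l i * e m i) = (if l = m then 1 else 0)" if "l < N" "m < N" for l m
    using arg_cong[OF P(2), of "\<lambda>B. B $$ (l, m)"] that P(1)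
    by (simp add: e_def scalar_prod_def atLeast0LessThan)
  have 3: "(\<Sum>l<N. e l i * e l j) = (if i = j then 1 else 0)" if "i < N" "j < N" for i j
    using arg_cong[OF PPT, of "\<lambda>B. B $$ (i, j)"] that P(1)
    by (simp add: e_def scalar_prod_def atLeast0LessThan)
  have A0: "0 \<le> Adj $$ (i, j)" if "i < N" "j < N" for i j
    using wg that by (auto simp: weighted_graph_def)
  have nonneg: "0 \<le> es ! l" if l: "l < N" for l
  proof -
    have "2 * (\<Sum>i<N. e l i * (es ! l * e l i)) = (\<Sum>i<N. \<Sum>j<N. Adj $$ (i, j) * (e l i - e l j)\<^sup>2)"
      using laplacian_quadratic_form[OF wg, of "e l"] 1[OF l] by simp
    also have "\<dots> \<ge> 0" using A0 by (intro sum_nonneg) auto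
    also have "(\<Sum>i<N. e l i * (es ! l * e l i)) = es ! l * (\<Sum>i<N. e l i * e l i)"
      by (simp add: sum_distrib_left mult_ac)
    finally show ?thesis using 2[OF l l] by simp
  qed
  have const: "e l i = e l j" if "es ! l = 0" "l < N" "i < N" "j < N" for l i j
    using laplacian_kernel_constant[OF wg conn, of "e l" i j] 1[of l] that by simp
  \<comment> \<open>The columns of the Laplacian sum to zero, so an eigenvector with nonzero
    eigenvalue has entry sum zero. If all modes were of this kind, so would be their combination
    that completeness equates with a unit vector, whose entry sum is 1.\<close>
  have "\<exists>l<N. es ! l = 0"
  proof (rule ccontr)
    assume contra: "\<not> (\<exists>l<N. es ! l = 0)"
    have c0: "(\<Sum>i<N. e l i) = 0" if l: "l < N" for l
    proof -
      have Lsym: "?L $$ (i, j) = ?L $$ (j, i)" if "i < N" "j < N" for i j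
        using arg_cong[OF L(2), of "\<lambda>B. B $$ (i, j)"] that L(1) by simp
      have row: "(\<Sum>j<N. ?L $$ (i, j)) = 0" if "i < N" for i
        using laplacian_apply[of Adj N i "\<lambda>_. 1"] wg that by (simp add: weighted_graph_def)
      have "es ! l * (\<Sum>i<N. e l i) = (\<Sum>i<N. \<Sum>j<N. ?L $$ (i, j) * e l j)"
        using 1[OF l] by (simp add: sum_distrib_left)
      also have "\<dots> = (\<Sum>j<N. \<Sum>i<N. ?L $$ (i, j) * e l j)" by (rule sum.swap)
      also have "\<dots> = (\<Sum>j<N. (\<Sum>i<N. ?L $$ (j, i)) * e l j)"
        by (intro sum.cong refl) (simp add: Lsym sum_distrib_right)
      finally show ?thesis using row contra l by simp
    qed
    have "(\<Sum>j<N. \<Sum>l<N. e l 0 * e l j) = (\<Sum>l<N. e l 0 * (\<Sum>j<N. e l j))"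
      by (subst sum.swap) (simp add: sum_distrib_left)
    moreover have "(\<Sum>j<N. \<Sum>l<N. e l 0 * e l j) = 1" using N by (simp add: 3)
    ultimately show False by (simp add: c0)
  qed
  then obtain l where "l < N" "es ! l = 0" by blast
  then have es0: "es ! 0 = 0"
    using nonneg[of 0] N sorted_nth_mono[OF es(3), of 0 l] es(2) by fastforce
  have const0: "e 0 i = e 0 j" if "i < N" "j < N" for i j using const[OF es0 _ that] N by simp
  \<comment> \<open>A second zero eigenvalue would give another constant mode, and two constant unit
    vectors are not orthogonal.\<close>
  have pos: "0 < es ! l" if "1 \<le> l" "l < N" for l
  proof (rule ccontr)
    assume "\<not> 0 < es ! l"
    then have "es ! l = 0" using nonneg[of l] that by simp
    then have c: "e l i = e l 0" if "i < N" for i using const[of l i 0] \<open>l < N\<close> that by simp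
    have c0: "e 0 i = e 0 0" if "i < N" for i using const0[of i 0] \<open>l < N\<close> that by simp
    have "(\<Sum>i<N. e l i * e 0 i) = (\<Sum>i<N. e l 0 * e 0 0)"
      by (intro sum.cong refl arg_cong2[where f = "(*)"] c c0) auto
    moreover have "(\<Sum>i<N. e l i * e l i) = (\<Sum>i<N. e l 0 * e l 0)"
      by (intro sum.cong refl arg_cong2[where f = "(*)"] c) auto
    moreover have "(\<Sum>i<N. e 0 i * e 0 i) = (\<Sum>i<N. e 0 0 * e 0 0)"
      by (intro sum.cong refl arg_cong2[where f = "(*)"] c0) auto
    ultimately have "real N * (e l 0 * e 0 0) = 0" "real N * (e l 0 * e l 0) = 1"
      "real N * (e 0 0 * e 0 0) = 1"
      using 2[of l 0] 2[of l l] 2[of 0 0] that by simp_all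
    then show False by auto
  qed
  show ?thesis
  proof (rule that[of e, unfolded ev])
    show "es ! l \<le> es ! m" if "l \<le> m" "m < N" for l m
      using sorted_nth_mono[OF es(3)] es(2) that by simp
  qed (rule 1 2 3 const0 pos; assumption)+
qed

subsection \<open>The gain condition\<close>

text \<open>\<open>S\<close> stands for \<mu>^2 + a^(2d) \<sigma>^2. The bracket equals 4 l2 lN /
  (l2 + lN)^2, and clearing positive denominators leaves the polynomial form in which the gain is
  analysed.\<close>

lemma consensus_inequality_iff:
  fixes a l2 lN \<mu> S :: real
  assumes "a \<ge> 1" "S > 0" "0 < l2" "0 < lN"
  shows "\<mu>\<^sup>2 / S * (1 - (lN - l2)\<^sup>2 / (l2 + lN)\<^sup>2) > 1 - 1 / a\<^sup>2 \<longleftrightarrow>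
    (a\<^sup>2 - 1) * (S * (l2 + lN)\<^sup>2) < 4 * a\<^sup>2 * \<mu>\<^sup>2 * (l2 * lN)"
proof -
  have s: "(l2 + lN)\<^sup>2 > 0" "a\<^sup>2 > 0" using assms by auto
  have "1 - (lN - l2)\<^sup>2 / (l2 + lN)\<^sup>2 = ((l2 + lN)\<^sup>2 - (lN - l2)\<^sup>2) / (l2 + lN)\<^sup>2"
    using s by (simp add: diff_divide_distrib)
  also have "(l2 + lN)\<^sup>2 - (lN - l2)\<^sup>2 = 4 * (l2 * lN)" by (simp add: power2_eq_square algebra_simps)
  finally have "\<mu>\<^sup>2 / S * (1 - (lN - l2)\<^sup>2 / (l2 + lN)\<^sup>2) = 4 * \<mu>\<^sup>2 * (l2 * lN) / (S * (l2 + lN)\<^sup>2)"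
    by simp
  moreover have "1 - 1 / a\<^sup>2 = (a\<^sup>2 - 1) / a\<^sup>2" using s by (simp add: diff_divide_distrib)
  ultimately show ?thesis using s assms(2) by (simp add: divide_less_eq less_divide_eq mult_ac)
qed

text \<open>The two conditions are combined with weights proportional to \<open>lN\<close> and \<open>l2\<close>, for which the
  resulting bound on \<open>a\<^sup>2 - 1\<close> is a concave quadratic in the gain with maximum the right-hand side.\<close>

lemma gain_necessary:
  fixes a b \<mu> K s l2 lN :: real
  assumes "0 < l2" "0 < lN" "\<mu>\<^sup>2 + s > 0"
    and "(a - \<mu> * b * (K * l2))\<^sup>2 + s * b\<^sup>2 * (K * l2)\<^sup>2 < 1"
    and "(a - \<mu> * b * (K * lN))\<^sup>2 + s * b\<^sup>2 * (K * lN)\<^sup>2 < 1"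
  shows "(a\<^sup>2 - 1) * ((\<mu>\<^sup>2 + s) * (l2 + lN)\<^sup>2) < 4 * a\<^sup>2 * \<mu>\<^sup>2 * (l2 * lN)"
proof -
  define S where "S = \<mu>\<^sup>2 + s"
  define h where "h = b * K"
  have e2: "a\<^sup>2 - 1 < 2 * a * \<mu> * h * l2 - S * h\<^sup>2 * l2\<^sup>2"
    using assms(4) by (simp add: S_def h_def power2_eq_square algebra_simps)
  have eN: "a\<^sup>2 - 1 < 2 * a * \<mu> * h * lN - S * h\<^sup>2 * lN\<^sup>2"
    using assms(5) by (simp add: S_def h_def power2_eq_square algebra_simps)
  have "(a\<^sup>2 - 1) * (l2 + lN) = lN * (a\<^sup>2 - 1) + l2 * (a\<^sup>2 - 1)" by (simp add: algebra_simps)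
  also have "\<dots> < lN * (2 * a * \<mu> * h * l2 - S * h\<^sup>2 * l2\<^sup>2) + l2 * (2 * a * \<mu> * h * lN - S * h\<^sup>2 * lN\<^sup>2)"
    using assms(1,2) e2 eN by (intro add_strict_mono mult_strict_left_mono)
  also have "\<dots> = l2 * lN * (4 * a * \<mu> * h - S * h\<^sup>2 * (l2 + lN))"
    by (simp add: power2_eq_square algebra_simps)
  finally have "(a\<^sup>2 - 1) * (l2 + lN) * (S * (l2 + lN)) <
      l2 * lN * (4 * a * \<mu> * h - S * h\<^sup>2 * (l2 + lN)) * (S * (l2 + lN))"
    using assms(1-3) by (intro mult_strict_right_mono) (auto simp: S_def)
  \<comment> \<open>Completing the square in \<open>h\<close>; the square vanishes exactly at the
    gain chosen in \<open>gain_sufficient\<close>.\<close>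
  also have "\<dots> = l2 * lN * (4 * a\<^sup>2 * \<mu>\<^sup>2 - (S * h * (l2 + lN) - 2 * a * \<mu>)\<^sup>2)"
    by (simp add: power2_eq_square algebra_simps)
  also have "\<dots> \<le> l2 * lN * (4 * a\<^sup>2 * \<mu>\<^sup>2)"
    using assms(1,2) by (intro mult_left_mono) auto
  finally show ?thesis by (simp add: S_def power2_eq_square mult_ac)
qed

text \<open>With this gain the condition at \<open>l\<close> is the assumed inequality with l (l2 +
  lN - l) in place of l2 lN. That product is concave in \<open>l\<close> and equals l2 lN at both
  ends of the interval, so it is at least as large in between.\<close>

lemma gain_sufficient:
  fixes a b \<mu> s l2 lN :: real
  assumes "0 < l2" "l2 \<le> l" "l \<le> lN" "\<mu>\<^sup>2 + s > 0" "b > 0"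
    and ineq: "(a\<^sup>2 - 1) * ((\<mu>\<^sup>2 + s) * (l2 + lN)\<^sup>2) < 4 * a\<^sup>2 * \<mu>\<^sup>2 * (l2 * lN)"
    and K: "K = 2 * a * \<mu> / (b * ((\<mu>\<^sup>2 + s) * (l2 + lN)))"
  shows "(a - \<mu> * b * (K * l))\<^sup>2 + s * b\<^sup>2 * (K * l)\<^sup>2 < 1"
proof -
  define S where "S = \<mu>\<^sup>2 + s"
  define h where "h = b * K"
  have S: "S > 0" and l: "l2 + lN > 0" using assms by (auto simp: S_def)
  have h: "h * (S * (l2 + lN)) = 2 * a * \<mu>" using S l assms(5) unfolding h_def K S_def[symmetric] by simp
  have "(a\<^sup>2 - 1) * (S * (l2 + lN)\<^sup>2) < 4 * a\<^sup>2 * \<mu>\<^sup>2 * (l2 * lN)" using ineq by (simp add: S_def)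
  also have "\<dots> \<le> 4 * a\<^sup>2 * \<mu>\<^sup>2 * (l * (l2 + lN - l))"
  proof -
    have "0 \<le> (l - l2) * (lN - l)" using assms by simp
    then have "l2 * lN \<le> l * (l2 + lN - l)" by (simp add: algebra_simps)
    then show ?thesis by (intro mult_left_mono) auto
  qed
  also have "\<dots> = (2 * a * \<mu>) * (2 * a * \<mu>) * (l * (l2 + lN - l))"
    by (simp add: power2_eq_square)
  \<comment> \<open>A polynomial identity in \<open>h\<close>. Its last two summands vanish by the
    fact \<open>h\<close>; they are inserted to trade factors 2 a \<mu> for factors containing the
    gain.\<close>
  also have "\<dots> = (2 * a * \<mu>) * (h * (S * (l2 + lN))) * (l * (l2 + lN)) -
      (h * (S * (l2 + lN))) * (h * (S * (l2 + lN))) * l\<^sup>2 +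
      ((2 * a * \<mu>) * (2 * a * \<mu>) - (2 * a * \<mu>) * (h * (S * (l2 + lN)))) * (l * (l2 + lN)) +
      ((h * (S * (l2 + lN))) * (h * (S * (l2 + lN))) - (2 * a * \<mu>) * (2 * a * \<mu>)) * l\<^sup>2"
    by (simp add: power2_eq_square algebra_simps)
  also have "\<dots> = (2 * a * \<mu>) * (h * (S * (l2 + lN))) * (l * (l2 + lN)) -
      (h * (S * (l2 + lN))) * (h * (S * (l2 + lN))) * l\<^sup>2"
    by (simp add: h)
  also have "\<dots> = (2 * a * \<mu> * h * l - S * h\<^sup>2 * l\<^sup>2) * (S * (l2 + lN)\<^sup>2)"
    by (simp add: power2_eq_square algebra_simps)
  finally have "(a\<^sup>2 - 1) * (S * (l2 + lN)\<^sup>2) < (2 * a * \<mu> * h * l - S * h\<^sup>2 * l\<^sup>2) * (S * (l2 + lN)\<^sup>2)" .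
  then have "a\<^sup>2 - 1 < 2 * a * \<mu> * h * l - S * h\<^sup>2 * l\<^sup>2"
    by (rule mult_right_less_imp_less) (use S in auto)
  then show ?thesis by (simp add: S_def h_def power2_eq_square algebra_simps)
qed

subsection \<open>Second moments for a Bernoulli process\<close>

locale bernoulli_process = prob_space M
  for M :: "'w measure" and \<gamma> :: "nat \<Rightarrow> 'w \<Rightarrow> real" and p :: real +
  assumes p_bounds: "0 < p" "p < 1"
    and indep: "indep_vars (\<lambda>_. borel) \<gamma> UNIV"
    and prob_0: "prob {\<omega> \<in> space M. \<gamma> k \<omega> = 0} = p"
    and prob_1: "prob {\<omega> \<in> space M. \<gamma> k \<omega> = 1} = 1 - p"
begin

text \<open>Besides measurability with respect to \<open>\<gamma> 0, \<dots>, \<gamma> (m - 1)\<close> this includes essential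
  boundedness, which makes integrability automatic.\<close>

definition adapted :: "nat \<Rightarrow> ('w \<Rightarrow> real) \<Rightarrow> bool" where
  "adapted m f \<longleftrightarrow>
     (\<exists>F \<in> borel_measurable (PiM {..<m} (\<lambda>_. borel)).
        \<forall>\<omega>\<in>space M. f \<omega> = F (\<lambda>i\<in>{..<m}. \<gamma> i \<omega>)) \<and>
     (\<exists>C. AE \<omega> in M. \<bar>f \<omega>\<bar> \<le> C)"

lemma measurable_gamma [measurable]: "\<gamma> k \<in> borel_measurable M"
  using indep by (auto simp: indep_vars_def)

text \<open>The masses of the two disjoint events add up to 1. Other values can occur on a null set,
  so \<open>adapted\<close> asks for a bound almost everywhere only.\<close>

lemma AE_gamma: "AE \<omega> in M. \<gamma> k \<omega> = 0 \<or> \<gamma> k \<omega> = 1"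
proof -
  have "prob {\<omega> \<in> space M. \<gamma> k \<omega> = 0 \<or> \<gamma> k \<omega> = 1} =
      prob ({\<omega> \<in> space M. \<gamma> k \<omega> = 0} \<union> {\<omega> \<in> space M. \<gamma> k \<omega> = 1})"
    by (rule arg_cong[where f = prob]) auto
  also have "\<dots> = prob {\<omega> \<in> space M. \<gamma> k \<omega> = 0} + prob {\<omega> \<in> space M. \<gamma> k \<omega> = 1}"
    by (rule finite_measure_Union) auto
  finally have "prob {\<omega> \<in> space M. \<gamma> k \<omega> = 0 \<or> \<gamma> k \<omega> = 1} = 1"
    by (simp add: prob_0 prob_1)
  then show ?thesis by (subst (asm) prob_Collect_eq_1) simp_all
qed

lemma adapted_cong:
  assumes "adapted m f" "\<And>\<omega>. \<omega> \<in> space M \<Longrightarrow> g \<omega> = f \<omega>"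
  shows "adapted m g"
proof -
  obtain C where "AE \<omega> in M. \<bar>f \<omega>\<bar> \<le> C" using assms by (auto simp: adapted_def)
  then have "AE \<omega> in M. \<bar>g \<omega>\<bar> \<le> C" using AE_space by eventually_elim (simp add: assms)
  then show ?thesis using assms by (fastforce simp: adapted_def)
qed

lemma adapted_const: "adapted m (\<lambda>_. c)"
  unfolding adapted_def by (intro conjI bexI[of _ "\<lambda>_. c"] exI[of _ "\<bar>c\<bar>"]) auto

lemma adapted_gamma: "k < m \<Longrightarrow> adapted m (\<gamma> k)"
  unfolding adapted_def
proof (intro conjI bexI[of _ "\<lambda>h. h k"] exI[of _ 1])
  show "AE \<omega> in M. \<bar>\<gamma> k \<omega>\<bar> \<le> 1"
    using AE_gamma[of k] by eventually_elim auto
qed auto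

text \<open>A function of a short history is one of a longer history, through restriction.\<close>

lemma adapted_mono:
  assumes "adapted m f" "m \<le> m'"
  shows "adapted m' f"
proof -
  obtain F C where F: "F \<in> borel_measurable (PiM {..<m} (\<lambda>_. borel))"
    "\<forall>\<omega>\<in>space M. f \<omega> = F (\<lambda>i\<in>{..<m}. \<gamma> i \<omega>)" "AE \<omega> in M. \<bar>f \<omega>\<bar> \<le> C"
    using assms by (auto simp: adapted_def)
  have "(\<lambda>h. F (restrict h {..<m})) \<in> borel_measurable (PiM {..<m'} (\<lambda>_. borel))"
    using F(1) assms(2) by (intro measurable_compose[OF measurable_restrict_subset F(1)]) auto
  moreover have "\<forall>\<omega>\<in>space M. f \<omega> = F (restrict (\<lambda>i\<in>{..<m'}. \<gamma> i \<omega>) {..<m})"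
    using F(2) assms(2) by (simp add: restrict_restrict Int_absorb1)
  ultimately show ?thesis
    using F(3) unfolding adapted_def
    by (intro conjI exI bexI[where x = "\<lambda>h. F (restrict h {..<m})"])
qed

lemma adapted_add:
  assumes "adapted m f" "adapted m g"
  shows "adapted m (\<lambda>\<omega>. f \<omega> + g \<omega>)"
proof -
  obtain F C where F: "F \<in> borel_measurable (PiM {..<m} (\<lambda>_. borel))"
    "\<forall>\<omega>\<in>space M. f \<omega> = F (\<lambda>i\<in>{..<m}. \<gamma> i \<omega>)" "AE \<omega> in M. \<bar>f \<omega>\<bar> \<le> C"
    using assms(1) by (auto simp: adapted_def)
  obtain G D where G: "G \<in> borel_measurable (PiM {..<m} (\<lambda>_. borel))"
    "\<forall>\<omega>\<in>space M. g \<omega> = G (\<lambda>i\<in>{..<m}. \<gamma> i \<omega>)" "AE \<omega> in M. \<bar>g \<omega>\<bar> \<le> D"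
    using assms(2) by (auto simp: adapted_def)
  have "AE \<omega> in M. \<bar>f \<omega> + g \<omega>\<bar> \<le> C + D"
    using F(3) G(3) by eventually_elim linarith
  moreover have "(\<lambda>h. F h + G h) \<in> borel_measurable (PiM {..<m} (\<lambda>_. borel))"
    using F(1) G(1) by measurable
  moreover have "\<forall>\<omega>\<in>space M. f \<omega> + g \<omega> = F (\<lambda>i\<in>{..<m}. \<gamma> i \<omega>) + G (\<lambda>i\<in>{..<m}. \<gamma> i \<omega>)"
    using F(2) G(2) by simp
  ultimately show ?thesis unfolding adapted_def by (intro conjI exI bexI[where x = "\<lambda>h. F h + G h"])
qed

lemma adapted_mult:
  assumes "adapted m f" "adapted m g"
  shows "adapted m (\<lambda>\<omega>. f \<omega> * g \<omega>)"
proof -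
  obtain F C where F: "F \<in> borel_measurable (PiM {..<m} (\<lambda>_. borel))"
    "\<forall>\<omega>\<in>space M. f \<omega> = F (\<lambda>i\<in>{..<m}. \<gamma> i \<omega>)" "AE \<omega> in M. \<bar>f \<omega>\<bar> \<le> C"
    using assms(1) by (auto simp: adapted_def)
  obtain G D where G: "G \<in> borel_measurable (PiM {..<m} (\<lambda>_. borel))"
    "\<forall>\<omega>\<in>space M. g \<omega> = G (\<lambda>i\<in>{..<m}. \<gamma> i \<omega>)" "AE \<omega> in M. \<bar>g \<omega>\<bar> \<le> D"
    using assms(2) by (auto simp: adapted_def)
  have "AE \<omega> in M. \<bar>f \<omega> * g \<omega>\<bar> \<le> C * D"
    using F(3) G(3) by eventually_elim (auto simp: abs_mult intro!: mult_mono)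
  moreover have "(\<lambda>h. F h * G h) \<in> borel_measurable (PiM {..<m} (\<lambda>_. borel))"
    using F(1) G(1) by measurable
  moreover have "\<forall>\<omega>\<in>space M. f \<omega> * g \<omega> = F (\<lambda>i\<in>{..<m}. \<gamma> i \<omega>) * G (\<lambda>i\<in>{..<m}. \<gamma> i \<omega>)"
    using F(2) G(2) by simp
  ultimately show ?thesis unfolding adapted_def by (intro conjI exI bexI[where x = "\<lambda>h. F h * G h"])
qed

lemma adapted_cmult: "adapted m f \<Longrightarrow> adapted m (\<lambda>\<omega>. c * f \<omega>)"
  by (intro adapted_mult adapted_const)

lemma adapted_diff:
  assumes "adapted m f" "adapted m g"
  shows "adapted m (\<lambda>\<omega>. f \<omega> - g \<omega>)"
  by (rule adapted_cong[OF adapted_add[OF assms(1) adapted_cmult[OF assms(2), of "-1"]]]) simp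

lemma adapted_power2: "adapted m f \<Longrightarrow> adapted m (\<lambda>\<omega>. (f \<omega>)\<^sup>2)"
  unfolding power2_eq_square by (rule adapted_mult)

lemma adapted_sum:
  "(\<And>i. i \<in> I \<Longrightarrow> adapted m (f i)) \<Longrightarrow> adapted m (\<lambda>\<omega>. \<Sum>i\<in>I. f i \<omega>)"
  by (induction I rule: infinite_finite_induct) (auto intro: adapted_const adapted_add)

lemma restrict_gamma_measurable:
  "(\<lambda>\<omega>. \<lambda>i\<in>A. \<gamma> i \<omega>) \<in> measurable M (PiM A (\<lambda>_. borel))"
  by (intro measurable_restrict) simp

lemma adapted_measurable: "adapted m f \<Longrightarrow> f \<in> borel_measurable M"
proof -
  assume "adapted m f"
  then obtain F where F: "F \<in> borel_measurable (PiM {..<m} (\<lambda>_. borel))"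
    "\<forall>\<omega>\<in>space M. f \<omega> = F (\<lambda>i\<in>{..<m}. \<gamma> i \<omega>)" by (auto simp: adapted_def)
  from measurable_compose[OF restrict_gamma_measurable F(1)] F(2) show ?thesis
    by (simp cong: measurable_cong)
qed

lemma adapted_integrable:
  assumes "adapted m f"
  shows "integrable M f"
proof -
  obtain C where "AE \<omega> in M. \<bar>f \<omega>\<bar> \<le> C" using assms by (auto simp: adapted_def)
  then show ?thesis
    using adapted_measurable[OF assms] by (intro integrable_const_bound[of _ C]) auto
qed

text \<open>Disjoint blocks of an independent family are independent, and the history that
  determines \<open>f\<close> stops strictly before \<open>m\<close>. The expectation of the product
  therefore factorises.\<close>

lemma adapted_indep_gamma:
  assumes f: "adapted m f" and h: "h \<in> borel_measurable borel" "integrable M (\<lambda>\<omega>. h (\<gamma> m \<omega>))"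
  shows "integrable M (\<lambda>\<omega>. h (\<gamma> m \<omega>) * f \<omega>)"
    and "expectation (\<lambda>\<omega>. h (\<gamma> m \<omega>) * f \<omega>) = expectation (\<lambda>\<omega>. h (\<gamma> m \<omega>)) * expectation f"
proof -
  obtain F where F: "F \<in> borel_measurable (PiM {..<m} (\<lambda>_. borel))"
    "\<And>\<omega>. \<omega> \<in> space M \<Longrightarrow> f \<omega> = F (\<lambda>i\<in>{..<m}. \<gamma> i \<omega>)" using f by (auto simp: adapted_def)
  have "indep_var borel ((\<lambda>r. h (r m)) \<circ> (\<lambda>\<omega>. \<lambda>i\<in>{m}. \<gamma> i \<omega>)) borel (F \<circ> (\<lambda>\<omega>. \<lambda>i\<in>{..<m}. \<gamma> i \<omega>))"
    using h(1) F(1)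
    by (intro indep_var_compose[OF indep_var_restrict[OF indep]]) auto
  moreover have "(\<lambda>r. h (r m)) \<circ> (\<lambda>\<omega>. \<lambda>i\<in>{m}. \<gamma> i \<omega>) = (\<lambda>\<omega>. h (\<gamma> m \<omega>))" by auto
  ultimately have iv: "indep_var borel (\<lambda>\<omega>. h (\<gamma> m \<omega>)) borel (\<lambda>\<omega>. F (\<lambda>i\<in>{..<m}. \<gamma> i \<omega>))"
    by (simp add: o_def)
  have intF: "integrable M (\<lambda>\<omega>. F (\<lambda>i\<in>{..<m}. \<gamma> i \<omega>))"
    using adapted_integrable[OF f] F(2) by (simp cong: Bochner_Integration.integrable_cong)
  show "integrable M (\<lambda>\<omega>. h (\<gamma> m \<omega>) * f \<omega>)"
    using indep_var_integrable[OF iv h(2) intF] F(2)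
    by (simp cong: Bochner_Integration.integrable_cong)
  show "expectation (\<lambda>\<omega>. h (\<gamma> m \<omega>) * f \<omega>) = expectation (\<lambda>\<omega>. h (\<gamma> m \<omega>)) * expectation f"
    using indep_var_lebesgue_integral[OF iv h(2) intF] F(2)
    by (simp cong: Bochner_Integration.integral_cong)
qed

text \<open>Almost everywhere the variable is a combination of the indicators of the two atoms, with
  coefficients \<open>h 0\<close> and \<open>h 1\<close>.\<close>

lemma expectation_of_gamma:
  fixes h :: "real \<Rightarrow> real"
  assumes "h \<in> borel_measurable borel"
  shows "integrable M (\<lambda>\<omega>. h (\<gamma> k \<omega>))"
    and "expectation (\<lambda>\<omega>. h (\<gamma> k \<omega>)) = p * h 0 + (1 - p) * h 1"
proof -
  define S0 where "S0 = {\<omega> \<in> space M. \<gamma> k \<omega> = 0}"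
  define S1 where "S1 = {\<omega> \<in> space M. \<gamma> k \<omega> = 1}"
  have S: "S0 \<in> events" "S1 \<in> events" by (auto simp: S0_def S1_def)
  have meas: "(\<lambda>\<omega>. h (\<gamma> k \<omega>)) \<in> borel_measurable M"
    using assms by measurable
  have ae: "AE \<omega> in M. h (\<gamma> k \<omega>) = indicator S0 \<omega> * h 0 + indicator S1 \<omega> * h 1"
    using AE_gamma[of k] AE_space by eventually_elim (auto simp: S0_def S1_def)
  have int: "integrable M (\<lambda>\<omega>. indicator S0 \<omega> * h 0 + indicator S1 \<omega> * h 1)"
    using S by (intro Bochner_Integration.integrable_add integrable_mult_left) (auto simp: emeasure_eq_measure)
  show "integrable M (\<lambda>\<omega>. h (\<gamma> k \<omega>))"
    using S by (subst integrable_cong_AE[OF meas _ ae]) (auto intro: int)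
  have "expectation (\<lambda>\<omega>. h (\<gamma> k \<omega>)) =
      expectation (\<lambda>\<omega>. indicator S0 \<omega> * h 0 + indicator S1 \<omega> * h 1)"
    using S by (intro integral_cong_AE[OF meas _ ae]) auto
  also have "\<dots> = p * h 0 + (1 - p) * h 1"
    using S prob_0[of k, folded S0_def] prob_1[of k, folded S1_def]
    by (subst Bochner_Integration.integral_add) (auto simp: emeasure_eq_measure)
  finally show "expectation (\<lambda>\<omega>. h (\<gamma> k \<omega>)) = p * h 0 + (1 - p) * h 1" .
qed

text \<open>After expanding the square, the cross term is the centred innovation times the adapted
  variable 2 f g, so it has mean zero by independence; the squared innovation contributes its
  variance p (1 - p).\<close>

lemma second_moment_innovation:
  assumes f: "adapted m f" and g: "adapted m g"
  shows "expectation (\<lambda>\<omega>. (f \<omega> + (\<gamma> m \<omega> - (1 - p)) * g \<omega>)\<^sup>2) =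
    expectation (\<lambda>\<omega>. (f \<omega>)\<^sup>2) + p * (1 - p) * expectation (\<lambda>\<omega>. (g \<omega>)\<^sup>2)"
proof -
  have fg: "adapted m (\<lambda>\<omega>. 2 * (f \<omega> * g \<omega>))" by (intro adapted_cmult adapted_mult f g)
  have gg: "adapted m (\<lambda>\<omega>. (g \<omega>)\<^sup>2)" by (intro adapted_power2 g)
  have ff: "integrable M (\<lambda>\<omega>. (f \<omega>)\<^sup>2)" by (rule adapted_integrable[OF adapted_power2[OF f]])
  let ?h1 = "\<lambda>x::real. x - (1 - p)" and ?h2 = "\<lambda>x::real. (x - (1 - p))\<^sup>2"
  have h1: "?h1 \<in> borel_measurable borel" and h2: "?h2 \<in> borel_measurable borel" by measurable
  note e1 = expectation_of_gamma[OF h1, of m] and e2 = expectation_of_gamma[OF h2, of m]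
  note i1 = adapted_indep_gamma[OF fg h1 e1(1)] and i2 = adapted_indep_gamma[OF gg h2 e2(1)]
  have "(\<lambda>\<omega>. (f \<omega> + (\<gamma> m \<omega> - (1 - p)) * g \<omega>)\<^sup>2) =
      (\<lambda>\<omega>. (f \<omega>)\<^sup>2 + ((\<gamma> m \<omega> - (1 - p)) * (2 * (f \<omega> * g \<omega>)) + (\<gamma> m \<omega> - (1 - p))\<^sup>2 * (g \<omega>)\<^sup>2))"
    by (auto simp: power2_eq_square algebra_simps)
  then have "expectation (\<lambda>\<omega>. (f \<omega> + (\<gamma> m \<omega> - (1 - p)) * g \<omega>)\<^sup>2) =
      expectation (\<lambda>\<omega>. (f \<omega>)\<^sup>2) + (expectation (\<lambda>\<omega>. (\<gamma> m \<omega> - (1 - p)) * (2 * (f \<omega> * g \<omega>))) +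
        expectation (\<lambda>\<omega>. (\<gamma> m \<omega> - (1 - p))\<^sup>2 * (g \<omega>)\<^sup>2))"
    using ff i1(1) i2(1) by (simp only: Bochner_Integration.integral_add Bochner_Integration.integrable_add)
  also have "\<dots> = expectation (\<lambda>\<omega>. (f \<omega>)\<^sup>2) + p * (1 - p) * expectation (\<lambda>\<omega>. (g \<omega>)\<^sup>2)"
    unfolding i1(2) i2(2) e1(2) e2(2) by (simp add: power2_eq_square algebra_simps)
  finally show ?thesis .
qed

section \<open>Convergence to zero in mean square\<close>

definition ms_null :: "(nat \<Rightarrow> 'w \<Rightarrow> real) \<Rightarrow> bool" where
  "ms_null f \<longleftrightarrow> (\<lambda>k. expectation (\<lambda>\<omega>. (f k \<omega>)\<^sup>2)) \<longlonglongrightarrow> 0"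

lemma ms_null_cong:
  assumes "ms_null f" "\<And>k \<omega>. \<omega> \<in> space M \<Longrightarrow> g k \<omega> = f k \<omega>"
  shows "ms_null g"
  using assms unfolding ms_null_def by (simp cong: Bochner_Integration.integral_cong)

lemma ms_null_cmult: "ms_null f \<Longrightarrow> ms_null (\<lambda>k \<omega>. c * f k \<omega>)"
  unfolding ms_null_def by (auto simp: power_mult_distrib intro: tendsto_mult_right_zero)

text \<open>Follows from (x + y)^2 \<le> 2 x^2 + 2 y^2. Adaptedness supplies the integrability; the
  two families may have different histories, as for a state and its successor.\<close>

lemma ms_null_add:
  assumes "ms_null f" "ms_null g" "\<And>k. adapted (m k) (f k)" "\<And>k. adapted (n k) (g k)"
  shows "ms_null (\<lambda>k \<omega>. f k \<omega> + g k \<omega>)"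
  unfolding ms_null_def
proof (rule tendsto_sandwich[where f = "\<lambda>_. 0"
      and h = "\<lambda>k. 2 * expectation (\<lambda>\<omega>. (f k \<omega>)\<^sup>2) + 2 * expectation (\<lambda>\<omega>. (g k \<omega>)\<^sup>2)"])
  have int: "integrable M (\<lambda>\<omega>. (f k \<omega>)\<^sup>2)" "integrable M (\<lambda>\<omega>. (g k \<omega>)\<^sup>2)"
    "integrable M (\<lambda>\<omega>. (f k \<omega> + g k \<omega>)\<^sup>2)" for k
  proof -
    have fg: "adapted (max (m k) (n k)) (f k)" "adapted (max (m k) (n k)) (g k)"
      using assms(3,4)[of k] by (auto intro: adapted_mono)
    then show "integrable M (\<lambda>\<omega>. (f k \<omega>)\<^sup>2)" "integrable M (\<lambda>\<omega>. (g k \<omega>)\<^sup>2)"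
      "integrable M (\<lambda>\<omega>. (f k \<omega> + g k \<omega>)\<^sup>2)"
      by (auto intro!: adapted_integrable adapted_power2 adapted_add)
  qed
  have "expectation (\<lambda>\<omega>. (f k \<omega> + g k \<omega>)\<^sup>2) \<le>
      2 * expectation (\<lambda>\<omega>. (f k \<omega>)\<^sup>2) + 2 * expectation (\<lambda>\<omega>. (g k \<omega>)\<^sup>2)" for k
  proof -
    have "(x + y)\<^sup>2 \<le> 2 * x\<^sup>2 + 2 * y\<^sup>2" for x y :: real
      using zero_le_power2[of "x - y"] by (simp add: power2_eq_square algebra_simps)
    then have "expectation (\<lambda>\<omega>. (f k \<omega> + g k \<omega>)\<^sup>2) \<le>
        expectation (\<lambda>\<omega>. 2 * (f k \<omega>)\<^sup>2 + 2 * (g k \<omega>)\<^sup>2)"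
      using int[of k] by (intro integral_mono) auto
    then show ?thesis using int[of k] by simp
  qed
  then show "\<forall>\<^sub>F k in sequentially. expectation (\<lambda>\<omega>. (f k \<omega> + g k \<omega>)\<^sup>2) \<le>
      2 * expectation (\<lambda>\<omega>. (f k \<omega>)\<^sup>2) + 2 * expectation (\<lambda>\<omega>. (g k \<omega>)\<^sup>2)" by simp
  show "(\<lambda>k. 2 * expectation (\<lambda>\<omega>. (f k \<omega>)\<^sup>2) + 2 * expectation (\<lambda>\<omega>. (g k \<omega>)\<^sup>2)) \<longlonglongrightarrow> 0"
    using assms(1,2) unfolding ms_null_def by (auto intro!: tendsto_add_zero tendsto_mult_right_zero)
qed auto

lemma ms_null_sum:
  assumes "\<And>i. i \<in> I \<Longrightarrow> ms_null (f i)" "\<And>i k. i \<in> I \<Longrightarrow> adapted (n k) (f i k)"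
  shows "ms_null (\<lambda>k \<omega>. \<Sum>i\<in>I. f i k \<omega>)"
  using assms
proof (induction I rule: infinite_finite_induct)
  case (insert i I)
  then have "ms_null (\<lambda>k \<omega>. f i k \<omega> + (\<Sum>i\<in>I. f i k \<omega>))"
    by (intro ms_null_add[of _ _ n n] adapted_sum) auto
  then show ?case using insert.hyps by simp
qed (auto simp: ms_null_def)

end

subsection \<open>Dynamics of a single mode\<close>

text \<open>As time advances by one, the newest input enters the window and the one of age
  \<open>d\<close> leaves it. Both the predictor and \<open>V\<close> contain such a window.\<close>

lemma telescoping_window:
  fixes f :: "nat \<Rightarrow> real"
  shows "(\<Sum>j = 1..d. f (j - 1)) = (\<Sum>j = 1..d. f j) + f 0 - f d"
  by (induction d) auto

text \<open>A mode detached from the graph: \<open>z\<close> and \<open>w\<close> are projections of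
  states and inputs, \<kappa> is the gain times the eigenvalue, and \<open>Y m\<close> predicts
  \<open>z (m + d)\<close> at time \<open>m\<close>. For negative \<open>t\<close>,
  \<open>nat t\<close> is 0, so the initial inputs are adapted to the empty history.\<close>

locale mode = bernoulli_process M \<gamma> p
  for M :: "'w measure" and \<gamma> p +
  fixes z :: "nat \<Rightarrow> 'w \<Rightarrow> real" and w :: "int \<Rightarrow> 'w \<Rightarrow> real" and a b \<kappa> :: real and d :: nat
    and Y :: "nat \<Rightarrow> 'w \<Rightarrow> real"
  assumes ab: "a \<ge> 1" "b > 0"
    and Y_def: "\<And>m \<omega>. Y m \<omega> =
      a ^ d * z m \<omega> + (1 - p) * (\<Sum>j = 1..d. a ^ (j - 1) * b * w (int m - int j) \<omega>)"
    and z_step: "\<And>k \<omega>. \<omega> \<in> space M \<Longrightarrow> z (Suc k) \<omega> = a * z k \<omega> + \<gamma> k \<omega> * b * w (int k - int d) \<omega>"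
    and feedback: "\<And>m \<omega>. \<omega> \<in> space M \<Longrightarrow> w (int m) \<omega> = - \<kappa> * Y m \<omega>"
    and adapted_z: "\<And>k. adapted k (z k)"
    and adapted_w: "\<And>t. t \<ge> - int d \<Longrightarrow> adapted (nat t) (w t)"
begin

text \<open>The input of age \<open>d\<close> leaves the predictor with its mean effect while the
  state receives its actual effect. The difference is the innovation term, amplified by
  \<open>a ^ d\<close>; the new input \<open>w m\<close> enters with mean gain and is replaced by
  the feedback.\<close>

lemma Y_step:
  assumes \<omega>: "\<omega> \<in> space M"
  shows "Y (Suc m) \<omega> = (a - (1 - p) * b * \<kappa>) * Y m \<omega> +
    (\<gamma> m \<omega> - (1 - p)) * (a ^ d * b * w (int m - int d) \<omega>)"
proof -
  let ?f = "\<lambda>j. a ^ j * w (int m - int j) \<omega>"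
  define S where "S = (\<Sum>j = 1..d. a ^ (j - 1) * b * w (int m - int j) \<omega>)"
  have "(\<Sum>j = 1..d. a ^ (j - 1) * b * w (int (Suc m) - int j) \<omega>) = b * (\<Sum>j = 1..d. ?f (j - 1))"
    unfolding sum_distrib_left
    by (intro sum.cong refl) (auto simp: of_nat_diff algebra_simps)
  also have "\<dots> = b * (\<Sum>j = 1..d. ?f j) + b * w (int m) \<omega> - b * (a ^ d * w (int m - int d) \<omega>)"
    unfolding telescoping_window[of ?f d] by (simp add: algebra_simps)
  also have "b * (\<Sum>j = 1..d. ?f j) = a * S"
    unfolding S_def sum_distrib_left
    by (intro sum.cong refl) (auto simp: mult_ac power_eq_if)
  finally have "(\<Sum>j = 1..d. a ^ (j - 1) * b * w (int (Suc m) - int j) \<omega>) =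
      a * S + b * w (int m) \<omega> - b * (a ^ d * w (int m - int d) \<omega>)" .
  then show ?thesis
    unfolding Y_def z_step[OF \<omega>] S_def[symmetric] feedback[OF \<omega>, unfolded Y_def, folded S_def]
    by (simp only:) (simp add: algebra_simps)
qed

text \<open>The number \<delta> of the overview. Its positivity is the condition on the gain in
  \<open>gain_necessary\<close> and \<open>gain_sufficient\<close>, with s = a^(2d) p (1 -
  p).\<close>

definition decay :: real where
  "decay = 1 - (a - (1 - p) * b * \<kappa>)\<^sup>2 - a ^ (2 * d) * (p * (1 - p)) * b\<^sup>2 * \<kappa>\<^sup>2"

text \<open>The delayed noise term has second moment proportional to that of \<open>w (m - d)\<close>, so \<open>V\<close>
  carries along the window of past inputs that have yet to enter.\<close>

definition V :: "nat \<Rightarrow> real" where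
  "V m = expectation (\<lambda>\<omega>. (Y m \<omega>)\<^sup>2) + a ^ (2 * d) * (p * (1 - p)) * b\<^sup>2 *
     (\<Sum>j = 1..d. expectation (\<lambda>\<omega>. (w (int m - int j) \<omega>)\<^sup>2))"

text \<open>At \<open>j = 0\<close> this says that the current input is already fixed by the history
  before \<open>m\<close>; \<open>j \<le> d\<close> keeps the time at or above -d.\<close>

lemma adapted_w': "j \<le> d \<Longrightarrow> adapted m (w (int m - int j))"
  by (rule adapted_mono[OF adapted_w]) auto

lemma adapted_Y: "adapted m (Y m)"
  unfolding Y_def[abs_def] by (intro adapted_add adapted_cmult adapted_sum adapted_z adapted_w') auto

text \<open>The noise adds the weighted second moment of the input of age \<open>d\<close>, and the
  window in \<open>V\<close> loses exactly this amount. What remains is the new input, whose second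
  moment is \<kappa>^2 times that of \<open>Y m\<close>.\<close>

lemma V_step: "V (Suc m) = V m - decay * expectation (\<lambda>\<omega>. (Y m \<omega>)\<^sup>2)"
proof -
  let ?q = "\<lambda>j. expectation (\<lambda>\<omega>. (w (int m - int j) \<omega>)\<^sup>2)"
  have "expectation (\<lambda>\<omega>. (Y (Suc m) \<omega>)\<^sup>2) = expectation (\<lambda>\<omega>. ((a - (1 - p) * b * \<kappa>) * Y m \<omega> +
      (\<gamma> m \<omega> - (1 - p)) * (a ^ d * b * w (int m - int d) \<omega>))\<^sup>2)"
    by (simp add: Y_step cong: Bochner_Integration.integral_cong)
  also have "\<dots> = expectation (\<lambda>\<omega>. ((a - (1 - p) * b * \<kappa>) * Y m \<omega>)\<^sup>2) +
      p * (1 - p) * expectation (\<lambda>\<omega>. (a ^ d * b * w (int m - int d) \<omega>)\<^sup>2)"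
    by (intro second_moment_innovation adapted_cmult adapted_Y adapted_w') simp
  also have "\<dots> = (a - (1 - p) * b * \<kappa>)\<^sup>2 * expectation (\<lambda>\<omega>. (Y m \<omega>)\<^sup>2) +
      a ^ (2 * d) * (p * (1 - p)) * b\<^sup>2 * ?q d"
    by (simp add: power_mult_distrib power_mult[symmetric] mult_ac)
  finally have 1: "expectation (\<lambda>\<omega>. (Y (Suc m) \<omega>)\<^sup>2) =
      (a - (1 - p) * b * \<kappa>)\<^sup>2 * expectation (\<lambda>\<omega>. (Y m \<omega>)\<^sup>2) +
      a ^ (2 * d) * (p * (1 - p)) * b\<^sup>2 * ?q d" .
  have 2: "(\<Sum>j = 1..d. expectation (\<lambda>\<omega>. (w (int (Suc m) - int j) \<omega>)\<^sup>2)) =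
      (\<Sum>j = 1..d. expectation (\<lambda>\<omega>. (w (int m - int j) \<omega>)\<^sup>2)) + ?q 0 - ?q d"
  proof -
    have "(\<Sum>j = 1..d. expectation (\<lambda>\<omega>. (w (int (Suc m) - int j) \<omega>)\<^sup>2)) = (\<Sum>j = 1..d. ?q (j - 1))"
      by (intro sum.cong refl) (auto simp: of_nat_diff algebra_simps)
    then show ?thesis using telescoping_window[of ?q d] by simp
  qed
  have 3: "?q 0 = \<kappa>\<^sup>2 * expectation (\<lambda>\<omega>. (Y m \<omega>)\<^sup>2)"
    by (simp add: feedback power_mult_distrib cong: Bochner_Integration.integral_cong)
  show ?thesis unfolding V_def 1 2 3 decay_def by (simp add: algebra_simps)
qed

lemma V_ge: "V m \<ge> expectation (\<lambda>\<omega>. (Y m \<omega>)\<^sup>2)"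
  unfolding V_def using p_bounds ab by (auto intro!: mult_nonneg_nonneg sum_nonneg)

lemma ms_null_w:
  assumes "ms_null Y"
  shows "ms_null (\<lambda>m. w (int m - int j))"
  unfolding ms_null_def
\<comment> \<open>The feedback law is available from time 0 on, so the sequence is shifted past the
  initial inputs.\<close>
proof (rule LIMSEQ_offset[of _ j])
  have "(\<lambda>m. \<kappa>\<^sup>2 * expectation (\<lambda>\<omega>. (Y m \<omega>)\<^sup>2)) \<longlonglongrightarrow> 0"
    using assms unfolding ms_null_def by (rule tendsto_mult_right_zero)
  then show "(\<lambda>m. expectation (\<lambda>\<omega>. (w (int (m + j) - int j) \<omega>)\<^sup>2)) \<longlonglongrightarrow> 0"
    by (simp add: feedback power_mult_distrib cong: Bochner_Integration.integral_cong)
qed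

text \<open>\<open>V\<close> is nonnegative and loses \<open>decay\<close> times the second moment
  of \<open>Y m\<close> in each step, so these moments are summable.\<close>

lemma ms_null_Y: "decay > 0 \<Longrightarrow> ms_null Y"
proof -
  assume d: "decay > 0"
  have "V m = V 0 - decay * (\<Sum>k<m. expectation (\<lambda>\<omega>. (Y k \<omega>)\<^sup>2))" for m
    by (induction m) (simp_all add: V_step algebra_simps)
  moreover have "V m \<ge> 0" for m by (rule order_trans[OF _ V_ge]) simp
  ultimately have "decay * (\<Sum>k<m. expectation (\<lambda>\<omega>. (Y k \<omega>)\<^sup>2)) \<le> V 0" for m
    by (metis diff_ge_0_iff_ge)
  then have "(\<Sum>k<m. expectation (\<lambda>\<omega>. (Y k \<omega>)\<^sup>2)) \<le> V 0 / decay" for m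
    using d by (simp add: field_simps)
  then have "summable (\<lambda>k. expectation (\<lambda>\<omega>. (Y k \<omega>)\<^sup>2))"
    by (intro summableI_nonneg_bounded[of _ "V 0 / decay"]) auto
  then show ?thesis unfolding ms_null_def by (rule summable_LIMSEQ_zero)
qed

text \<open>The predictor is solved for the state: past inputs vanish along with \<open>Y\<close>,
  and \<open>a ^ d\<close> is invertible.\<close>

lemma ms_null_z:
  assumes "decay > 0"
  shows "ms_null z"
proof -
  have Y: "ms_null Y" by (rule ms_null_Y[OF assms])
  let ?W = "\<lambda>m \<omega>. \<Sum>j = 1..d. a ^ (j - 1) * b * w (int m - int j) \<omega>"
  have W: "ms_null ?W"
    by (rule ms_null_sum[where n = "\<lambda>m. m"]) (auto intro!: ms_null_cmult ms_null_w Y adapted_cmult adapted_w')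
  have aW: "adapted m (?W m)" for m by (intro adapted_sum adapted_cmult adapted_w') auto
  have "ms_null (\<lambda>m \<omega>. inverse (a ^ d) * (Y m \<omega> + (- (1 - p)) * ?W m \<omega>))"
    by (intro ms_null_cmult ms_null_add[where m = "\<lambda>m. m" and n = "\<lambda>m. m"] Y W adapted_Y adapted_cmult aW)
  then show ?thesis
    by (rule ms_null_cong) (use ab in \<open>simp add: Y_def field_simps\<close>)
qed

text \<open>If \<open>decay\<close> is not positive, \<open>V\<close> never falls below
  \<open>V 0\<close>, which is positive. But if \<open>z\<close> vanishes, the plant equation makes
  the transmitted inputs vanish, then independence the inputs themselves, hence \<open>Y\<close> and
  \<open>V\<close>.\<close>

lemma decay_pos_if_ms_null:
  assumes z: "ms_null z" and Y0: "expectation (\<lambda>\<omega>. (Y 0 \<omega>)\<^sup>2) > 0"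
  shows "decay > 0"
proof (rule ccontr)
  assume "\<not> decay > 0"
  then have "V (Suc m) \<ge> V m" for m
    by (simp add: V_step mult_nonpos_nonneg)
  then have V0: "V m \<ge> V 0" for m by (induction m) (auto intro: order_trans)
  have zS: "ms_null (\<lambda>m. z (Suc m))" using z unfolding ms_null_def by (rule LIMSEQ_Suc)
  have "ms_null (\<lambda>m \<omega>. z (Suc m) \<omega> + (- a) * z m \<omega>)"
    by (rule ms_null_add[OF zS ms_null_cmult[OF z], where m = Suc and n = "\<lambda>m. m"]) (intro adapted_z adapted_cmult)+
  then have "ms_null (\<lambda>m \<omega>. inverse b * (z (Suc m) \<omega> + (- a) * z m \<omega>))" by (rule ms_null_cmult)
  then have "ms_null (\<lambda>m \<omega>. \<gamma> m \<omega> * w (int m - int d) \<omega>)"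
    by (rule ms_null_cong) (use ab in \<open>simp add: z_step\<close>)
  \<comment> \<open>The delayed input is independent of \<gamma>(m), whose second moment is 1 - p >
    0; so losses cannot hide inputs that stay large.\<close>
  moreover have "expectation (\<lambda>\<omega>. (\<gamma> m \<omega> * w (int m - int d) \<omega>)\<^sup>2) =
      (1 - p) * expectation (\<lambda>\<omega>. (w (int m - int d) \<omega>)\<^sup>2)" for m
  proof -
    have h: "(\<lambda>x::real. x\<^sup>2) \<in> borel_measurable borel" by measurable
    note e = expectation_of_gamma[OF h, of m]
    show ?thesis
      using adapted_indep_gamma(2)[OF adapted_power2[OF adapted_w'] h e(1), of d] e(2)
      by (simp add: power_mult_distrib)
  qed
  ultimately have "(\<lambda>m. (1 - p) * expectation (\<lambda>\<omega>. (w (int m - int d) \<omega>)\<^sup>2)) \<longlonglongrightarrow> 0"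
    by (simp add: ms_null_def)
  then have "(\<lambda>m. inverse (1 - p) * ((1 - p) * expectation (\<lambda>\<omega>. (w (int m - int d) \<omega>)\<^sup>2))) \<longlonglongrightarrow> 0"
    by (rule tendsto_mult_right_zero)
  then have "(\<lambda>m. expectation (\<lambda>\<omega>. (w (int m - int d) \<omega>)\<^sup>2)) \<longlonglongrightarrow> 0"
    using p_bounds by (simp add: mult.assoc[symmetric])
  from LIMSEQ_ignore_initial_segment[OF this, of d]
  have w0: "(\<lambda>m. expectation (\<lambda>\<omega>. (w (int m) \<omega>)\<^sup>2)) \<longlonglongrightarrow> 0" by simp
  have wj: "ms_null (\<lambda>m. w (int m - int j))" for j
    unfolding ms_null_def by (rule LIMSEQ_offset[of _ j]) (use w0 in simp)
  have "ms_null Y"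
    unfolding Y_def[abs_def]
    by (intro ms_null_add[where m = "\<lambda>m. m" and n = "\<lambda>m. m"] ms_null_cmult z ms_null_sum[where n = "\<lambda>m. m"] wj adapted_cmult
        adapted_z adapted_sum adapted_w') auto
  then have "V \<longlonglongrightarrow> 0 + a ^ (2 * d) * (p * (1 - p)) * b\<^sup>2 * (\<Sum>j = 1..d. 0)"
    unfolding V_def[abs_def] using wj
    by (intro tendsto_add tendsto_mult tendsto_const tendsto_sum) (auto simp: ms_null_def)
  then have "V \<longlonglongrightarrow> 0" by simp
  then have "V 0 \<le> 0" by (rule LIMSEQ_le_const) (use V0 in auto)
  with V_ge[of 0] Y0 show False by simp
qed

end

subsection \<open>Decomposition of the closed loop into modes\<close>

text \<open>Weights vanish outside the neighbourhood, so the sum may run over all vertices. The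
  protocol is read at k = m + d, where it determines the input of time \<open>m\<close>.\<close>

lemma protocol_laplacian:
  assumes wg: "weighted_graph N Adj" and i: "i < N"
    and prot: "predictor_protocol Adj a b d \<mu> K x u"
  shows "u i (int m) = - K * (\<Sum>j<N. laplacian Adj $$ (i, j) * predicted_state a b d \<mu> x u j (m + d))"
proof -
  let ?P = "\<lambda>j. predicted_state a b d \<mu> x u j (m + d)"
  have A: "Adj \<in> carrier_mat N N" "dim_row Adj = N" "\<And>j. j < N \<Longrightarrow> 0 \<le> Adj $$ (i, j)"
    using wg i by (auto simp: weighted_graph_def)
  have "u i (int (m + d) - int d) = K * (\<Sum>j\<in>neighbours Adj i. Adj $$ (i, j) * (?P j - ?P i))"
    using prot i A(2) unfolding predictor_protocol_def by (metis le_add2)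
  also have "(\<Sum>j\<in>neighbours Adj i. Adj $$ (i, j) * (?P j - ?P i)) = (\<Sum>j<N. Adj $$ (i, j) * (?P j - ?P i))"
  proof (rule sum.mono_neutral_left)
    show "\<forall>j\<in>{..<N} - neighbours Adj i. Adj $$ (i, j) * (?P j - ?P i) = 0"
      using A(2,3) i by (force simp: neighbours_def edges_def)
  qed (use A(2) in \<open>auto simp: neighbours_def edges_def\<close>)
  also have "\<dots> = - (\<Sum>j<N. Adj $$ (i, j) * (?P i - ?P j))"
    by (simp add: sum_negf[symmetric] algebra_simps)
  also have "(\<Sum>j<N. Adj $$ (i, j) * (?P i - ?P j)) = (\<Sum>j<N. laplacian Adj $$ (i, j) * ?P j)"
    by (rule laplacian_apply[OF A(1) i, symmetric])
  finally show ?thesis by simp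
qed

context bernoulli_process
begin

text \<open>Measurability and boundedness are not assumed of the processes but follow from the
  recursion: initial values are constants, and each step combines earlier quantities with one
  further \<gamma>.\<close>

lemma adapted_closed_loop:
  assumes wg: "weighted_graph N Adj"
    and cl: "\<And>\<omega>. \<omega> \<in> space M \<Longrightarrow> closed_loop Adj a b d \<mu> K x0 u0
      (\<lambda>k. \<gamma> k \<omega>) (\<lambda>i k. x i k \<omega>) (\<lambda>i t. u i t \<omega>)"
    and i: "i < N"
  shows "adapted k (x i k)" and "t \<ge> - int d \<Longrightarrow> adapted (nat t) (u i t)"
proof -
  have N: "dim_row Adj = N" using wg by (auto simp: weighted_graph_def)
  have "\<forall>i<N. adapted k (x i k) \<and> (\<forall>t. - int d \<le> t \<and> t < int k \<longrightarrow> adapted (nat t) (u i t))" for k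
  proof (induction k)
    case 0
    show ?case
    proof (intro allI impI conjI)
      fix i assume i: "i < N"
      show "adapted 0 (x i 0)"
        by (rule adapted_cong[OF adapted_const[of 0 "x0 i"]])
          (use cl i in \<open>auto simp: closed_loop_def initial_values_def N\<close>)
      fix t assume t: "- int d \<le> t \<and> t < int 0"
      then have "nat (- t) \<in> {1..d}" "t = - int (nat (- t))" by auto
      then have "u i t \<omega> = u0 i (nat (- t))" if "\<omega> \<in> space M" for \<omega>
        using cl[OF that] i unfolding closed_loop_def initial_values_def N by metis
      then show "adapted (nat t) (u i t)" by (rule adapted_cong[OF adapted_const])
    qed
  next
    case (Suc k)
    \<comment> \<open>The input of time \<open>k\<close> uses only the state at \<open>k\<close> and
      earlier inputs. It precedes the state update because for d = 0 that update already needs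
      it.\<close>
    have uk: "adapted k (u i (int k))" if i: "i < N" for i
    proof (rule adapted_cong)
      show "u i (int k) \<omega> = - K * (\<Sum>j<N. laplacian Adj $$ (i, j) *
          predicted_state a b d \<mu> (\<lambda>i k. x i k \<omega>) (\<lambda>i t. u i t \<omega>) j (k + d))"
        if "\<omega> \<in> space M" for \<omega>
        by (rule protocol_laplacian[OF wg i]) (use cl[OF that] in \<open>simp add: closed_loop_def\<close>)
      show "adapted k (\<lambda>\<omega>. - K * (\<Sum>j<N. laplacian Adj $$ (i, j) *
          predicted_state a b d \<mu> (\<lambda>i k. x i k \<omega>) (\<lambda>i t. u i t \<omega>) j (k + d)))"
      proof (intro adapted_cmult adapted_sum)
        fix j assume "j \<in> {..<N}"
        then have j: "j < N" by simp
        have "adapted k (u j (int (k + d) - int d - int l))" if "l \<in> {1..d}" for l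
        proof (rule adapted_mono[of "nat (int (k + d) - int d - int l)"])
          show "adapted (nat (int (k + d) - int d - int l)) (u j (int (k + d) - int d - int l))"
            using Suc that j by auto
        qed simp
        moreover have "adapted k (x j k)" using Suc j by blast
        ultimately show "adapted k (\<lambda>\<omega>. predicted_state a b d \<mu> (\<lambda>i k. x i k \<omega>) (\<lambda>i t. u i t \<omega>) j (k + d))"
          unfolding predicted_state_def diff_add_inverse2
          by (intro adapted_add adapted_cmult adapted_sum)
      qed
    qed
    have us: "adapted (nat t) (u i t)" if "i < N" "- int d \<le> t" "t < int (Suc k)" for i t
      using uk Suc that by (cases "t = int k") auto
    have "adapted (Suc k) (x i (Suc k))" if i: "i < N" for i
    proof (rule adapted_cong)
      show "x i (Suc k) \<omega> = a * x i k \<omega> + b * (\<gamma> k \<omega> * u i (int k - int d) \<omega>)"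
        if "\<omega> \<in> space M" for \<omega>
        using cl[OF that] i by (simp add: closed_loop_def plant_def N)
      have "adapted (Suc k) (u i (int k - int d))"
        using us[OF i, of "int k - int d"] by (rule adapted_mono) auto
      moreover have "adapted (Suc k) (x i k)"
        using Suc i by (auto intro: adapted_mono[of k])
      ultimately show "adapted (Suc k) (\<lambda>\<omega>. a * x i k \<omega> + b * (\<gamma> k \<omega> * u i (int k - int d) \<omega>))"
        by (intro adapted_add adapted_cmult adapted_mult adapted_gamma) auto
    qed
    with us show ?case by blast
  qed
  note all = this
  show "adapted k (x i k)" using all i by blast
  show "adapted (nat t) (u i t)" if "t \<ge> - int d" using all[of "nat (t + 1)"] i that by auto
qed

text \<open>Projection commutes with the plant and the predictor, which act on all agents alike.
  Only the feedback mixes agents, through the Laplacian, and on an eigenvector that is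
  multiplication by \<open>lam\<close>.\<close>

lemma mode_of_closed_loop:
  assumes wg: "weighted_graph N Adj" and ab: "a \<ge> 1" "b > 0"
    and cl: "\<And>\<omega>. \<omega> \<in> space M \<Longrightarrow> closed_loop Adj a b d (1 - p) K x0 u0
      (\<lambda>k. \<gamma> k \<omega>) (\<lambda>i k. x i k \<omega>) (\<lambda>i t. u i t \<omega>)"
    and e: "\<And>i. i < N \<Longrightarrow> (\<Sum>j<N. laplacian Adj $$ (i, j) * e j) = lam * e i"
  shows "mode M \<gamma> p (\<lambda>k \<omega>. \<Sum>i<N. e i * x i k \<omega>) (\<lambda>t \<omega>. \<Sum>i<N. e i * u i t \<omega>) a b (K * lam) d
    (\<lambda>m \<omega>. a ^ d * (\<Sum>i<N. e i * x i m \<omega>) +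
       (1 - p) * (\<Sum>j = 1..d. a ^ (j - 1) * b * (\<Sum>i<N. e i * u i (int m - int j) \<omega>)))"
proof unfold_locales
  have N: "dim_row Adj = N" using wg by (auto simp: weighted_graph_def)
  show "(\<Sum>i<N. e i * x i (Suc k) \<omega>) =
      a * (\<Sum>i<N. e i * x i k \<omega>) + \<gamma> k \<omega> * b * (\<Sum>i<N. e i * u i (int k - int d) \<omega>)"
    if "\<omega> \<in> space M" for k \<omega>
  proof -
    have "x i (Suc k) \<omega> = a * x i k \<omega> + \<gamma> k \<omega> * b * u i (int k - int d) \<omega>" if "i < N" for i
      using cl[OF \<open>\<omega> \<in> space M\<close>] that by (simp add: closed_loop_def plant_def N)
    then have "(\<Sum>i<N. e i * x i (Suc k) \<omega>) =
        (\<Sum>i<N. a * (e i * x i k \<omega>) + \<gamma> k \<omega> * b * (e i * u i (int k - int d) \<omega>))"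
      by (intro sum.cong refl) (simp add: algebra_simps)
    then show ?thesis by (simp only: sum.distrib sum_distrib_left)
  qed
  show "(\<Sum>i<N. e i * u i (int m) \<omega>) = - (K * lam) * (a ^ d * (\<Sum>i<N. e i * x i m \<omega>) +
       (1 - p) * (\<Sum>j = 1..d. a ^ (j - 1) * b * (\<Sum>i<N. e i * u i (int m - int j) \<omega>)))"
    if \<omega>: "\<omega> \<in> space M" for m \<omega>
  proof -
    let ?P = "\<lambda>j. predicted_state a b d (1 - p) (\<lambda>i k. x i k \<omega>) (\<lambda>i t. u i t \<omega>) j (m + d)"
    let ?L = "laplacian Adj"
    note L = laplacian_symmetric[OF wg]
    have Lsym: "?L $$ (i, j) = ?L $$ (j, i)" if "i < N" "j < N" for i j
      using arg_cong[OF L(2), of "\<lambda>B. B $$ (i, j)"] that L(1) by simp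
    have u: "u i (int m) \<omega> = - K * (\<Sum>j<N. ?L $$ (i, j) * ?P j)" if "i < N" for i
      by (rule protocol_laplacian[OF wg that]) (use cl[OF \<omega>] in \<open>simp add: closed_loop_def\<close>)
    have "(\<Sum>i<N. e i * u i (int m) \<omega>) = (\<Sum>i<N. \<Sum>j<N. - K * (e i * ?L $$ (i, j) * ?P j))"
      using u by (intro sum.cong refl) (simp add: sum_distrib_left sum_negf mult_ac)
    also have "\<dots> = (\<Sum>j<N. \<Sum>i<N. - K * (e i * ?L $$ (i, j) * ?P j))" by (rule sum.swap)
    \<comment> \<open>Symmetry moves the Laplacian from the predictions onto the
      eigenvector.\<close>
    also have "\<dots> = (\<Sum>j<N. - K * ((\<Sum>i<N. ?L $$ (j, i) * e i) * ?P j))"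
      by (intro sum.cong refl) (simp add: sum_distrib_left sum_distrib_right sum_negf Lsym mult_ac)
    also have "\<dots> = - (K * lam) * (\<Sum>j<N. e j * ?P j)"
      unfolding sum_distrib_left by (intro sum.cong refl) (simp add: e)
    also have "(\<Sum>j<N. e j * ?P j) = (\<Sum>i<N. a ^ d * (e i * x i m \<omega>)) +
        (\<Sum>i<N. \<Sum>j = 1..d. (1 - p) * (a ^ (j - 1) * b * (e i * u i (int m - int j) \<omega>)))"
      unfolding sum.distrib[symmetric]
      by (intro sum.cong refl) (simp add: predicted_state_def sum_distrib_left distrib_left mult_ac)
    also have "(\<Sum>i<N. \<Sum>j = 1..d. (1 - p) * (a ^ (j - 1) * b * (e i * u i (int m - int j) \<omega>))) =
        (1 - p) * (\<Sum>j = 1..d. a ^ (j - 1) * b * (\<Sum>i<N. e i * u i (int m - int j) \<omega>))"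
      by (subst sum.swap) (simp only: sum_distrib_left)
    finally show ?thesis by (simp only: sum_distrib_left)
  qed
  show "adapted k (\<lambda>\<omega>. \<Sum>i<N. e i * x i k \<omega>)" for k
    using adapted_closed_loop(1)[OF wg cl] by (intro adapted_sum adapted_cmult) auto
  show "adapted (nat t) (\<lambda>\<omega>. \<Sum>i<N. e i * u i t \<omega>)" if "t \<ge> - int d" for t
    using adapted_closed_loop(2)[OF wg cl _ that] by (intro adapted_sum adapted_cmult) auto
qed (use ab in auto)

text \<open>Starting at the eigenvector with zero past inputs excites the mode. As the entries of
  \<open>e\<close> sum to zero, the mode is a combination of the disagreements x i - x 0 and
  vanishes with them.\<close>

lemma mode_gain_if_consensus:
  assumes N: "0 < N" and wg: "weighted_graph N Adj" and ab: "a \<ge> 1" "b > 0"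
    and e: "\<And>i. i < N \<Longrightarrow> (\<Sum>j<N. laplacian Adj $$ (i, j) * e j) = lam * e i"
    and e1: "(\<Sum>i<N. e i * e i) = 1" and e0: "(\<Sum>i<N. e i) = 0"
    and cons: "\<And>x0 u0 x u i j. (\<And>\<omega>. \<omega> \<in> space M \<Longrightarrow> closed_loop Adj a b d (1 - p) K x0 u0
        (\<lambda>k. \<gamma> k \<omega>) (\<lambda>i k. x i k \<omega>) (\<lambda>i t. u i t \<omega>)) \<Longrightarrow>
      i < N \<Longrightarrow> j < N \<Longrightarrow> ms_null (\<lambda>k \<omega>. x j k \<omega> - x i k \<omega>)"
  shows "(a - (1 - p) * b * (K * lam))\<^sup>2 + a ^ (2 * d) * (p * (1 - p)) * b\<^sup>2 * (K * lam)\<^sup>2 < 1"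
proof -
  have Nd: "dim_row Adj = N" using wg by (auto simp: weighted_graph_def)
  \<comment> \<open>Trajectories are chosen separately for each sample point;
    \<open>adapted_closed_loop\<close> makes the choice measurable.\<close>
  have "\<forall>\<omega>. \<exists>x u. closed_loop Adj a b d (1 - p) K e (\<lambda>_ _. 0) (\<lambda>k. \<gamma> k \<omega>) x u"
    using closed_loop_exists by blast
  then obtain xs us where cl': "closed_loop Adj a b d (1 - p) K e (\<lambda>_ _. 0) (\<lambda>k. \<gamma> k \<omega>) (xs \<omega>) (us \<omega>)" for \<omega>
    by metis
  define x where "x i k \<omega> = xs \<omega> i k" for i k \<omega>
  define u where "u i k \<omega> = us \<omega> i k" for i k \<omega>
  have cl: "closed_loop Adj a b d (1 - p) K e (\<lambda>_ _. 0)
      (\<lambda>k. \<gamma> k \<omega>) (\<lambda>i k. x i k \<omega>) (\<lambda>i t. u i t \<omega>)" for \<omega>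
    using cl'[of \<omega>] by (simp add: x_def u_def)
  interpret mode M \<gamma> p "\<lambda>k \<omega>. \<Sum>i<N. e i * x i k \<omega>" "\<lambda>t \<omega>. \<Sum>i<N. e i * u i t \<omega>" a b "K * lam" d
    "\<lambda>m \<omega>. a ^ d * (\<Sum>i<N. e i * x i m \<omega>) +
       (1 - p) * (\<Sum>j = 1..d. a ^ (j - 1) * b * (\<Sum>i<N. e i * u i (int m - int j) \<omega>))"
    by (rule mode_of_closed_loop[OF wg ab cl e])
  have "ms_null (\<lambda>k \<omega>. \<Sum>i<N. e i * (x i k \<omega> - x 0 k \<omega>))"
    by (rule ms_null_sum[where n = "\<lambda>k. k"])
      (auto intro!: ms_null_cmult cons[OF cl] adapted_cmult adapted_diff adapted_closed_loop(1)[OF wg cl] N)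
  moreover have "(\<Sum>i<N. e i * (x i k \<omega> - x 0 k \<omega>)) = (\<Sum>i<N. e i * x i k \<omega>)" for k \<omega>
    using e0 by (simp add: right_diff_distrib sum_subtractf flip: sum_distrib_right)
  ultimately have z: "ms_null (\<lambda>k \<omega>. \<Sum>i<N. e i * x i k \<omega>)" by simp
  have x0: "x i 0 \<omega> = e i" and u0: "l \<in> {1..d} \<Longrightarrow> u i (- int l) \<omega> = 0" if "i < N" for i l \<omega>
    using cl[of \<omega>] that by (auto simp: closed_loop_def initial_values_def Nd)
  \<comment> \<open>The initial predictor is the nonzero constant \<open>a ^ d\<close>, as
    \<open>decay_pos_if_ms_null\<close> requires.\<close>
  have "a ^ d * (\<Sum>i<N. e i * x i 0 \<omega>) +
      (1 - p) * (\<Sum>j = 1..d. a ^ (j - 1) * b * (\<Sum>i<N. e i * u i (int 0 - int j) \<omega>)) = a ^ d" for \<omega>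
    by (simp add: x0 u0 e1)
  then have "decay > 0"
    by (intro decay_pos_if_ms_null z) (use ab in \<open>simp add: prob_space\<close>)
  then show ?thesis by (simp add: decay_def)
qed

text \<open>Completeness expands the states in modes. Mode 0 cancels in the difference of two agents
  because \<open>e 0\<close> is constant, and every other mode vanishes by
  \<open>ms_null_z\<close>.\<close>

lemma consensus_if_mode_gains:
  assumes wg: "weighted_graph N Adj" and ab: "a \<ge> 1" "b > 0"
    and cl: "\<And>\<omega>. \<omega> \<in> space M \<Longrightarrow> closed_loop Adj a b d (1 - p) K x0 u0
      (\<lambda>k. \<gamma> k \<omega>) (\<lambda>i k. x i k \<omega>) (\<lambda>i t. u i t \<omega>)"
    and e: "\<And>l i. l < N \<Longrightarrow> i < N \<Longrightarrow> (\<Sum>j<N. laplacian Adj $$ (i, j) * e l j) = lam l * e l i"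
    and complete: "\<And>i j. i < N \<Longrightarrow> j < N \<Longrightarrow> (\<Sum>l<N. e l i * e l j) = (if i = j then 1 else 0)"
    and const: "\<And>i j. i < N \<Longrightarrow> j < N \<Longrightarrow> e 0 i = e 0 j"
    and gain: "\<And>l. 1 \<le> l \<Longrightarrow> l < N \<Longrightarrow>
      (a - (1 - p) * b * (K * lam l))\<^sup>2 + a ^ (2 * d) * (p * (1 - p)) * b\<^sup>2 * (K * lam l)\<^sup>2 < 1"
    and ij: "i < N" "j < N"
  shows "ms_null (\<lambda>k \<omega>. x j k \<omega> - x i k \<omega>)"
proof -
  let ?z = "\<lambda>l k \<omega>. \<Sum>i<N. e l i * x i k \<omega>"
  have z: "ms_null (?z l)" if l: "1 \<le> l" "l < N" for l
  proof -
    interpret mode M \<gamma> p "?z l" "\<lambda>t \<omega>. \<Sum>i<N. e l i * u i t \<omega>" a b "K * lam l" d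
      "\<lambda>m \<omega>. a ^ d * (\<Sum>i<N. e l i * x i m \<omega>) +
         (1 - p) * (\<Sum>j = 1..d. a ^ (j - 1) * b * (\<Sum>i<N. e l i * u i (int m - int j) \<omega>))"
      by (rule mode_of_closed_loop[OF wg ab cl e]) (use l in auto)
    show ?thesis by (rule ms_null_z) (use gain[OF l] in \<open>simp add: decay_def\<close>)
  qed
  have expand: "x i k \<omega> = (\<Sum>l<N. e l i * ?z l k \<omega>)" if "i < N" for i k \<omega>
  proof -
    have "(\<Sum>l<N. e l i * ?z l k \<omega>) = (\<Sum>l<N. \<Sum>j<N. e l i * e l j * x j k \<omega>)"
      by (simp add: sum_distrib_left mult_ac)
    also have "\<dots> = (\<Sum>j<N. \<Sum>l<N. e l i * e l j * x j k \<omega>)" by (rule sum.swap)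
    also have "\<dots> = (\<Sum>j<N. if i = j then x j k \<omega> else 0)"
      by (intro sum.cong refl) (simp add: complete[OF that] flip: sum_distrib_right)
    finally show ?thesis using that by simp
  qed
  have "ms_null (\<lambda>k \<omega>. \<Sum>l\<in>{1..<N}. (e l j - e l i) * ?z l k \<omega>)"
    by (rule ms_null_sum[where n = "\<lambda>k. k"])
      (auto intro!: ms_null_cmult z adapted_cmult adapted_sum adapted_closed_loop(1)[OF wg cl])
  moreover have "x j k \<omega> - x i k \<omega> = (\<Sum>l\<in>{1..<N}. (e l j - e l i) * ?z l k \<omega>)" for k \<omega>
  proof -
    have "x j k \<omega> - x i k \<omega> = (\<Sum>l<N. (e l j - e l i) * ?z l k \<omega>)"
      unfolding expand[OF ij(1)] expand[OF ij(2)] by (simp add: left_diff_distrib sum_subtractf)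
    also have "\<dots> = (\<Sum>l\<in>{1..<N}. (e l j - e l i) * ?z l k \<omega>)"
    proof (rule sum.mono_neutral_right)
      show "\<forall>l\<in>{..<N} - {1..<N}. (e l j - e l i) * ?z l k \<omega> = 0"
        using const[OF ij] by (auto simp: not_le)
    qed auto
    finally show ?thesis .
  qed
  ultimately show ?thesis by simp
qed

end

section \<open>Consensusability as existence of one gain for all nonconstant modes\<close>

theorem theorem5:
  fixes N d :: nat
    and Adj :: "real mat"
    and a b p \<mu> \<sigma> :: real
    and M :: "'w measure"
    and \<gamma> :: "nat \<Rightarrow> 'w \<Rightarrow> real"
  assumes "N \<ge> 2"
    and "weighted_graph N Adj"
    and "connected_graph Adj"
    and "a \<ge> 1"
    and "b > 0"
    and "0 < p" "p < 1"
    and "\<mu> = 1 - p"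
    and "\<sigma>\<^sup>2 = p * (1 - p)"
    and "prob_space M"
    and "prob_space.indep_vars M (\<lambda>_. borel) \<gamma> UNIV"
    and "\<And>k. measure M {\<omega> \<in> space M. \<gamma> k \<omega> = 0} = p"
    and "\<And>k. measure M {\<omega> \<in> space M. \<gamma> k \<omega> = 1} = 1 - p"
  shows "mean_square_consensusable M \<gamma> Adj a b d \<mu> \<longleftrightarrow>
    \<mu>\<^sup>2 / (\<mu>\<^sup>2 + a ^ (2 * d) * \<sigma>\<^sup>2) *
      (1 - (lap_eigenvalue Adj N - lap_eigenvalue Adj 2)\<^sup>2 /
           (lap_eigenvalue Adj 2 + lap_eigenvalue Adj N)\<^sup>2)
    > 1 - 1 / a\<^sup>2"
proof -
  note wg = assms(2) and ab = assms(4,5)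
  interpret bernoulli_process M \<gamma> p
    using assms by (simp add: bernoulli_process_def bernoulli_process_axioms_def)
  have Nd: "dim_row Adj = N" using wg by (auto simp: weighted_graph_def)
  obtain e where
      e: "\<And>l i. l < N \<Longrightarrow> i < N \<Longrightarrow>
         (\<Sum>j<N. laplacian Adj $$ (i, j) * e l j) = lap_eigenvalue Adj (Suc l) * e l i"
    and orth: "\<And>l m. l < N \<Longrightarrow> m < N \<Longrightarrow> (\<Sum>i<N. e l i * e m i) = (if l = m then 1 else 0)"
    and complete: "\<And>i j. i < N \<Longrightarrow> j < N \<Longrightarrow> (\<Sum>l<N. e l i * e l j) = (if i = j then 1 else 0)"
    and const: "\<And>i j. i < N \<Longrightarrow> j < N \<Longrightarrow> e 0 i = e 0 j"
    and pos: "\<And>l. 1 \<le> l \<Longrightarrow> l < N \<Longrightarrow> 0 < lap_eigenvalue Adj (Suc l)"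
    and sorted: "\<And>l m. l \<le> m \<Longrightarrow> m < N \<Longrightarrow> lap_eigenvalue Adj (Suc l) \<le> lap_eigenvalue Adj (Suc m)"
    by (rule laplacian_modes[OF assms(1-3)]) blast
  define l2 where "l2 = lap_eigenvalue Adj 2"
  define lN where "lN = lap_eigenvalue Adj N"
  have l2: "l2 = lap_eigenvalue Adj (Suc 1)" "0 < l2"
    using pos[of 1] assms(1) by (simp_all add: l2_def numeral_2_eq_2)
  have lN: "lN = lap_eigenvalue Adj (Suc (N - 1))" "0 < lN"
    using pos[of "N - 1"] assms(1) by (simp_all add: lN_def)
  \<comment> \<open>The variance of \<gamma>, times the square of the amplification
    \<open>a ^ d\<close> of the innovation in the predictor.\<close>
  define s where "s = a ^ (2 * d) * (p * (1 - p))"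
  have s: "s \<ge> 0" using assms(4,6,7) by (simp add: s_def)
  have \<mu>: "\<mu> > 0" using assms by simp
  have S: "\<mu>\<^sup>2 + s > 0" using s \<mu> by (simp add: add_pos_nonneg)
  have "\<mu>\<^sup>2 / (\<mu>\<^sup>2 + a ^ (2 * d) * \<sigma>\<^sup>2) * (1 - (lN - l2)\<^sup>2 / (l2 + lN)\<^sup>2) > 1 - 1 / a\<^sup>2 \<longleftrightarrow>
      (a\<^sup>2 - 1) * ((\<mu>\<^sup>2 + s) * (l2 + lN)\<^sup>2) < 4 * a\<^sup>2 * \<mu>\<^sup>2 * (l2 * lN)" (is "_ \<longleftrightarrow> ?ineq")
    unfolding assms(9) s_def[symmetric] by (rule consensus_inequality_iff[OF ab(1) S l2(2) lN(2)])
  moreover have "mean_square_consensusable M \<gamma> Adj a b d \<mu> \<longleftrightarrow> ?ineq"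
  proof
    assume "mean_square_consensusable M \<gamma> Adj a b d \<mu>"
    then obtain K where K: "\<And>x0 u0 x u i j. (\<And>\<omega>. \<omega> \<in> space M \<Longrightarrow> closed_loop Adj a b d (1 - p) K x0 u0
        (\<lambda>k. \<gamma> k \<omega>) (\<lambda>i k. x i k \<omega>) (\<lambda>i t. u i t \<omega>)) \<Longrightarrow>
      i < N \<Longrightarrow> j < N \<Longrightarrow> ms_null (\<lambda>k \<omega>. x j k \<omega> - x i k \<omega>)"
      unfolding mean_square_consensusable_def Nd assms(8) ms_null_def power2_abs by blast
    have gain: "(a - \<mu> * b * (K * lap_eigenvalue Adj (Suc l)))\<^sup>2 +
        s * b\<^sup>2 * (K * lap_eigenvalue Adj (Suc l))\<^sup>2 < 1" if l: "1 \<le> l" "l < N" for l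
      unfolding s_def assms(8)
    proof (rule mode_gain_if_consensus[OF _ wg ab e[OF l(2)]])
      show "(\<Sum>i<N. e l i * e l i) = 1" using orth[OF l(2,2)] by simp
      have c: "e 0 i = e 0 0" if "i < N" for i by (rule const) (use that l in auto)
      \<comment> \<open>The constant mode \<open>e 0\<close> has norm 1 and so is nonzero;
        orthogonality to it therefore means entry sum zero.\<close>
      have "(\<Sum>i<N. e 0 i * e 0 i) = (\<Sum>i<N. e 0 0 * e 0 0)"
        by (intro sum.cong refl arg_cong2[where f = "(*)"] c) auto
      then have "e 0 0 \<noteq> 0" using orth[of 0 0] l by auto
      moreover have "(\<Sum>i<N. e l i * e 0 i) = (\<Sum>i<N. e l i * e 0 0)"
        by (intro sum.cong refl arg_cong2[where f = "(*)"] c) auto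
      ultimately show "(\<Sum>i<N. e l i) = 0"
        using orth[of l 0] l by (simp flip: sum_distrib_right)
    qed (use assms(1) in simp, assumption, rule K)
    \<comment> \<open>The two extreme modes suffice: indices 1 and N - 1 carry \<open>l2\<close> and
      \<open>lN\<close>, and coincide when N = 2.\<close>
    show ?ineq
      by (rule gain_necessary[OF l2(2) lN(2) S]) (use gain[of 1] gain[of "N - 1"] l2 lN assms(1) in auto)
  next
    assume ineq: ?ineq
    \<comment> \<open>The maximiser of the concave quadratic bound from
      \<open>gain_necessary\<close>.\<close>
    define K where "K = 2 * a * \<mu> / (b * ((\<mu>\<^sup>2 + s) * (l2 + lN)))"
    have "(a - \<mu> * b * (K * lap_eigenvalue Adj (Suc l)))\<^sup>2 +
        s * b\<^sup>2 * (K * lap_eigenvalue Adj (Suc l))\<^sup>2 < 1" if l: "1 \<le> l" "l < N" for l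
    proof (rule gain_sufficient[OF l2(2) _ _ S ab(2) ineq K_def])
      show "l2 \<le> lap_eigenvalue Adj (Suc l)" unfolding l2(1) using l by (intro sorted) auto
      show "lap_eigenvalue Adj (Suc l) \<le> lN" unfolding lN(1) using l by (intro sorted) auto
    qed
    note gain = this[unfolded s_def assms(8)]
    show "mean_square_consensusable M \<gamma> Adj a b d \<mu>"
      unfolding mean_square_consensusable_def Nd assms(8)
    proof (intro exI[of _ K] allI impI)
      fix x0 u0 x u i j
      assume "\<forall>\<omega>\<in>space M. closed_loop Adj a b d (1 - p) K x0 u0
          (\<lambda>k. \<gamma> k \<omega>) (\<lambda>i k. x i k \<omega>) (\<lambda>i t. u i t \<omega>)" and ij: "i < N" "j < N"
      then have cl: "closed_loop Adj a b d (1 - p) K x0 u0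
          (\<lambda>k. \<gamma> k \<omega>) (\<lambda>i k. x i k \<omega>) (\<lambda>i t. u i t \<omega>)" if "\<omega> \<in> space M" for \<omega>
        using that by blast
      show "(\<lambda>k. \<integral>\<omega>. \<bar>x j k \<omega> - x i k \<omega>\<bar>\<^sup>2 \<partial>M) \<longlonglongrightarrow> 0"
        using consensus_if_mode_gains[OF wg ab cl e complete const gain ij]
        by (simp add: ms_null_def)
    qed
  qed
  ultimately show ?thesis unfolding l2_def lN_def by simp
qed

end
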